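(* Let $A\in\mathbb R^{n\times n}$ be Hurwitz, $B,v\in\mathbb R^n$ with $(A,B)$ controllable, and $\kappa>0$. Define $G(\mathrm j\omega)=(\mathrm j\omega I_n-A)^{-1}B$ and $$f(\omega,\kappa,\vartheta,v)=2\,\mathrm{Re}\{v^\top G(\mathrm j\omega)\}+\kappa|v^\top G(\mathrm j\omega)|^2-\vartheta\|G(\mathrm j\omega)\|^2 .$$ For $\psi>0$ consider the LMI in $P\in\mathrm S^n$: $$A^\top P+PA+(\psi+\kappa\|v\|^2)I_n-\kappa vv^\top\le0,\qquad PB=v, \tag{L}$$ and let $\Psi=\{\psi>0:\ (L)\text{ is feasible}\}$. Then $\Psi\neq\emptyset$ if and only if $f(\omega,\kappa,\kappa\|v\|^2,v)>0$ for all $\omega\in\mathbb R$ and $\lim_{\omega\to\infty}\|G(\mathrm j\omega)\|^{-2}f(\omega,\kappa,\kappa\|v\|^2,v)>0$. If $\Psi\neq\emptyset$, then every solution $P\in\mathrm S^n$ of (L) with $\psi\in\Psi$ satisfies $P>0$ and $Q:=-(A^\top P+PA)>0$. Moreover, for such $\psi$ and $P$, if there exists $\omega\in\mathbb R$ with $f(\omega,0,\psi+\kappa\|v\|^2,v)<0$, then $\lambda_{\min}(Q+PBB^\top P)>\lambda_{\min}(Q)$.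
   Context: $\mathrm S^n$: real symmetric $n\times n$ matrices, with Loewner order; $\mathrm j$ is the imaginary unit; $\|\cdot\|$ is the Euclidean norm on $\mathbb C^n$. *)

theory Defs
  imports "HOL-Analysis.Analysis"
begin

definition cmat :: "real^'n^'m \<Rightarrow> complex^'n^'m" where
  "cmat A = (\<chi> i j. complex_of_real (A $ i $ j))"

definition cvec :: "real^'n \<Rightarrow> complex^'n" where
  "cvec x = (\<chi> i. complex_of_real (x $ i))"

definition hurwitz :: "real^'n^'n \<Rightarrow> bool" where
  "hurwitz A \<longleftrightarrow> (\<forall>z::complex. det (mat z - cmat A) = 0 \<longrightarrow> Re z < 0)"

text \<open>Kalman controllability: the controllability matrix [B, AB, ..., A^(n-1) B] has rank n,
  i.e. its columns span R^n.\<close>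
definition controllable :: "real^'n^'n \<Rightarrow> real^'n \<Rightarrow> bool" where
  "controllable A B \<longleftrightarrow> span {((\<lambda>x. A *v x) ^^ k) B | k. k < CARD('n)} = UNIV"

definition Gtf :: "real^'n^'n \<Rightarrow> real^'n \<Rightarrow> real \<Rightarrow> complex^'n" where
  "Gtf A B w = matrix_inv (mat (\<i> * complex_of_real w) - cmat A) *v cvec B"

definition vtG :: "real^'n \<Rightarrow> complex^'n \<Rightarrow> complex" where
  "vtG v z = (\<Sum>i\<in>UNIV. complex_of_real (v $ i) * z $ i)"

definition ffun :: "real^'n^'n \<Rightarrow> real^'n \<Rightarrow> real \<Rightarrow> real \<Rightarrow> real \<Rightarrow> real^'n \<Rightarrow> real" where
  "ffun A B w \<kappa> \<theta> v =
     2 * Re (vtG v (Gtf A B w)) + \<kappa> * (cmod (vtG v (Gtf A B w)))\<^sup>2 - \<theta> * (norm (Gtf A B w))\<^sup>2"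

definition symmetric_mat :: "real^'n^'n \<Rightarrow> bool" where
  "symmetric_mat P \<longleftrightarrow> transpose P = P"

definition neg_semidef :: "real^'n^'n \<Rightarrow> bool" where
  "neg_semidef M \<longleftrightarrow> (\<forall>x. x \<bullet> (M *v x) \<le> 0)"

definition pos_def :: "real^'n^'n \<Rightarrow> bool" where
  "pos_def M \<longleftrightarrow> (\<forall>x. x \<noteq> 0 \<longrightarrow> x \<bullet> (M *v x) > 0)"

definition outer :: "real^'n \<Rightarrow> real^'n \<Rightarrow> real^'n^'n" where
  "outer x y = (\<chi> i j. x $ i * y $ j)"

definition lambda_min :: "real^'n^'n \<Rightarrow> real" where
  "lambda_min M = Min {e. \<exists>x. x \<noteq> 0 \<and> M *v x = e *\<^sub>R x}"

definition LMI :: "real^'n^'n \<Rightarrow> real^'n \<Rightarrow> real^'n \<Rightarrow> real \<Rightarrow> real \<Rightarrow> real^'n^'n \<Rightarrow> bool" where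
  "LMI A B v \<kappa> \<psi> P \<longleftrightarrow> symmetric_mat P \<and>
     neg_semidef (transpose A ** P + P ** A + (\<psi> + \<kappa> * (norm v)\<^sup>2) *\<^sub>R mat 1 - \<kappa> *\<^sub>R outer v v) \<and>
     P *v B = v"

definition Psi_set :: "real^'n^'n \<Rightarrow> real^'n \<Rightarrow> real^'n \<Rightarrow> real \<Rightarrow> real set" where
  "Psi_set A B v \<kappa> = {\<psi>. \<psi> > 0 \<and> (\<exists>P. LMI A B v \<kappa> \<psi> P)}"

end

theory Submission
  imports
    Defs
    "HOL-Complex_Analysis.Complex_Analysis"
    "HOL-Computational_Algebra.Fundamental_Theorem_Algebra"
begin

text \<open>The quadratic form of \<open>A\<^sup>TP + PA\<close> at \<open>G(\<i>\<omega>)\<close> equals \<open>-2 Re (B\<^sup>TP G(\<i>\<omega>))\<close>; this yields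
  necessity and \<open>\<lambda>\<^sub>m\<^sub>i\<^sub>n(Q) < \<psi> + \<kappa>\<parallel>v\<parallel>\<^sup>2\<close> in the last claim, where a minimal eigenvector of \<open>Q + vv\<^sup>T\<close> with no
  gain over \<open>Q\<close> would be orthogonal to \<open>v\<close>. Also \<open>Re (B\<^sup>TP G) \<ge> 0\<close> on the imaginary axis extends to the
  right half plane by the maximum principle, and the expansion at infinity gives \<open>B\<^sup>TPB \<ge> 0\<close>, whence
  \<open>P > 0\<close>. For sufficiency, the two frequency
  conditions yield, by compactness, some \<open>\<psi> > 0\<close> with \<open>f(\<omega>, \<kappa>, \<psi> + \<kappa>\<parallel>v\<parallel>\<^sup>2, v) > 0\<close> for all \<open>\<omega>\<close>.
  After multiplication by \<open>|a(\<i>\<omega>)|\<^sup>2\<close>, with \<open>a\<close> the characteristic polynomial, this is a positive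
  polynomial in \<open>\<omega>\<^sup>2\<close>, hence has a spectral factorisation \<open>|h(\<i>\<omega>)|\<^sup>2\<close>; controllability gives
  \<open>h/a = l\<^sup>TG\<close> for a real vector \<open>l\<close>. The solution \<open>P\<close> of the Lyapunov equation
  \<open>A\<^sup>TP + PA = \<kappa>vv\<^sup>T - (\<psi> + \<kappa>\<parallel>v\<parallel>\<^sup>2)I - ll\<^sup>T\<close> then satisfies \<open>Re ((PB - v)\<^sup>TG(\<i>\<omega>)) = 0\<close> for all \<open>\<omega>\<close>,
  which forces \<open>PB = v\<close>, again by the maximum principle.\<close>

subsection \<open>Real polynomials on the imaginary axis\<close>

abbreviation cpoly :: "real poly \<Rightarrow> complex \<Rightarrow> complex" where
  "cpoly p z \<equiv> poly (map_poly complex_of_real p) z"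

lemma cpoly_pCons: "cpoly (pCons c p) z = complex_of_real c + z * cpoly p z"
  by (simp add: map_poly_pCons)

lemma cpoly_add: "cpoly (p + q) z = cpoly p z + cpoly q z"
proof -
  have "map_poly complex_of_real (p + q) = map_poly complex_of_real p + map_poly complex_of_real q"
    by (rule poly_eqI) (simp add: coeff_map_poly)
  then show ?thesis by simp
qed

lemma cpoly_smult: "cpoly (smult c p) z = complex_of_real c * cpoly p z"
  by (simp add: map_poly_smult)

lemma cpoly_mult: "cpoly (p * q) z = cpoly p z * cpoly q z"
  by (induction p) (simp_all add: cpoly_add cpoly_smult map_poly_pCons algebra_simps)

lemma cpoly_sum: "cpoly (\<Sum>i\<in>S. p i) z = (\<Sum>i\<in>S. cpoly (p i) z)"
  by (induction S rule: infinite_finite_induct) (simp_all add: cpoly_add)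

lemma cpoly_of_real: "cpoly p (complex_of_real x) = complex_of_real (poly p x)"
  by (induction p) (simp_all add: map_poly_pCons)

lemma cnj_cpoly: "cnj (cpoly p z) = cpoly p (cnj z)"
  by (induction p) (simp_all add: map_poly_pCons)

lemma degree_cpoly: "degree (map_poly complex_of_real p) = degree p"
  by (simp add: degree_map_poly)

text \<open>On the imaginary axis even powers are real and odd powers imaginary. Each
  \<open>pCons\<close> multiplies by i w, which swaps the two parts and turns \<open>(e, d)\<close>
  into \<open>(pCons c (- d), e)\<close>. The bound on \<open>d\<close> exempts
  \<open>d = 0\<close>, whose degree 0 would violate it for constant \<open>p\<close>.\<close>

lemma cpoly_imaginary_axis:
  "\<exists>e d. (\<forall>w. cpoly p (\<i> * complex_of_real w) = Complex (poly e (w\<^sup>2)) (w * poly d (w\<^sup>2)))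
     \<and> 2 * degree e \<le> degree p \<and> (d \<noteq> 0 \<longrightarrow> 2 * degree d + 1 \<le> degree p)"
proof (induction p)
  case 0
  show ?case by (intro exI[of _ 0]) (simp add: complex_eq_iff)
next
  case (pCons c p)
  then obtain e d where ed: "\<And>w. cpoly p (\<i> * complex_of_real w) = Complex (poly e (w\<^sup>2)) (w * poly d (w\<^sup>2))"
    "2 * degree e \<le> degree p" "d \<noteq> 0 \<Longrightarrow> 2 * degree d + 1 \<le> degree p" by blast
  \<comment> \<open>For \<open>p = 0\<close> the new polynomial has degree 0, so the bound on its
    odd part \<open>e\<close> can only hold with \<open>e = 0\<close>; the degree bound alone gives
    just a constant.\<close>
  have p0: "p = 0 \<Longrightarrow> e = 0"
  proof -
    assume "p = 0"
    then have "poly e (w\<^sup>2) = 0" for w using ed(1)[of w] by (simp add: complex_eq_iff)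
    moreover have "degree e = 0" using ed(2) \<open>p = 0\<close> by simp
    ultimately show "e = 0" by (metis degree_eq_zeroE mult_zero_right poly_const_conv poly_pCons
      add.right_neutral pCons_0_0)
  qed
  show ?case
  proof (intro exI conjI allI impI)
    fix w :: real
    show "cpoly (pCons c p) (\<i> * complex_of_real w)
      = Complex (poly (pCons c (- d)) (w\<^sup>2)) (w * poly e (w\<^sup>2))"
      by (simp add: map_poly_pCons ed(1) complex_eq_iff power2_eq_square algebra_simps)
    show "2 * degree (pCons c (- d)) \<le> degree (pCons c p)"
      using ed(3) by (cases "d = 0"; cases "p = 0") (auto)
    assume "e \<noteq> 0"
    then show "2 * degree e + 1 \<le> degree (pCons c p)" using ed(2) p0 by auto
  qed
qed

text \<open>With even and odd parts \<open>e\<close>, \<open>d\<close> and \<open>e'\<close>,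
  \<open>d'\<close> the real part is e e' + w^2 d d'. Passing from w to w^2 halves the degree, which
  later keeps the spectral factor strictly proper.\<close>

lemma even_part_poly:
  "\<exists>g. 2 * degree g \<le> degree p + degree r \<and>
     (\<forall>w. Re (cpoly p (\<i> * complex_of_real w) * cnj (cpoly r (\<i> * complex_of_real w))) = poly g (w\<^sup>2))"
proof -
  obtain e d where p: "\<And>w. cpoly p (\<i> * complex_of_real w) = Complex (poly e (w\<^sup>2)) (w * poly d (w\<^sup>2))"
    "2 * degree e \<le> degree p" "d \<noteq> 0 \<Longrightarrow> 2 * degree d + 1 \<le> degree p"
    using cpoly_imaginary_axis[of p] by blast
  obtain e' d' where r: "\<And>w. cpoly r (\<i> * complex_of_real w) = Complex (poly e' (w\<^sup>2)) (w * poly d' (w\<^sup>2))"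
    "2 * degree e' \<le> degree r" "d' \<noteq> 0 \<Longrightarrow> 2 * degree d' + 1 \<le> degree r"
    using cpoly_imaginary_axis[of r] by blast
  let ?g = "e * e' + pCons 0 (d * d')"
  have "2 * degree (e * e') \<le> degree p + degree r"
    using p(2) r(2) degree_mult_le[of e e'] by linarith
  moreover have "2 * degree (pCons 0 (d * d')) \<le> degree p + degree r"
  proof (cases "d = 0 \<or> d' = 0")
    case True then show ?thesis by auto
  next
    case False
    then show ?thesis using p(3) r(3) degree_mult_eq[of d d'] by auto
  qed
  ultimately have "2 * degree ?g \<le> degree p + degree r"
    using degree_add_le_max[of "e * e'" "pCons 0 (d * d')"] by linarith
  moreover have "Re (cpoly p (\<i> * complex_of_real w) * cnj (cpoly r (\<i> * complex_of_real w))) = poly ?g (w\<^sup>2)" for w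
    by (simp add: p(1) r(1) power2_eq_square algebra_simps)
  ultimately show ?thesis by blast
qed

text \<open>Induction on the degree, splitting off one real factor per complex root z of g. A real
  root is negative, and t - z corresponds to s + sqrt (-z). A non-real root gives t^2 - 2 (Re z) t +
  |z|^2, which corresponds to s^2 + sqrt (2 |z| - 2 Re z) s + |z|.\<close>

lemma positive_poly_spectral_factor:
  fixes g :: "real poly"
  assumes "\<And>t. t \<ge> 0 \<Longrightarrow> poly g t > 0"
  shows "\<exists>h. degree h \<le> degree g \<and>
    (\<forall>w. poly g (w\<^sup>2) = (cmod (cpoly h (\<i> * complex_of_real w)))\<^sup>2)"
  using assms
proof (induction "degree g" arbitrary: g rule: less_induct)
  case less
  \<comment> \<open>Both kinds of root share this reduction: the cofactor of a positive factor is
    again positive on t >= 0, and spectral factors multiply.\<close>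
  have step: ?case
    if g: "g = q * g'" and q: "degree q > 0" "\<And>t. t \<ge> 0 \<Longrightarrow> poly q t > 0"
      and k: "degree k \<le> degree q" "\<And>w. poly q (w\<^sup>2) = (cmod (cpoly k (\<i> * complex_of_real w)))\<^sup>2"
    for q g' k
  proof -
    have "g \<noteq> 0" using less.prems[of 0] by auto
    then have deg: "degree g = degree q + degree g'" using g by (simp add: degree_mult_eq)
    have "poly g' t > 0" if "t \<ge> 0" for t
      using less.prems[OF that] q(2)[OF that] g by (simp add: zero_less_mult_iff)
    moreover have "degree g' < degree g" using deg q(1) by simp
    ultimately obtain h where h: "degree h \<le> degree g'"
      "\<And>w. poly g' (w\<^sup>2) = (cmod (cpoly h (\<i> * complex_of_real w)))\<^sup>2"
      using less.hyps by blast
    have "degree (k * h) \<le> degree g" using degree_mult_le[of k h] h(1) k(1) deg by linarith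
    moreover have "poly g (w\<^sup>2) = (cmod (cpoly (k * h) (\<i> * complex_of_real w)))\<^sup>2" for w
      by (simp add: g k(2) h(2) cpoly_mult norm_mult power_mult_distrib)
    ultimately show ?thesis by blast
  qed
  show ?case
  proof (cases "degree g = 0")
    case True
    then obtain c where c: "g = [:c:]" by (meson degree_eq_zeroE)
    then have "c > 0" using less.prems[of 0] by simp
    then have "\<forall>w. poly g (w\<^sup>2) = (cmod (cpoly [:sqrt c:] (\<i> * complex_of_real w)))\<^sup>2"
      by (simp add: c map_poly_pCons)
    then show ?thesis by (metis degree_pCons_0 le0)
  next
    case False
    then have "\<not> constant (poly (map_poly complex_of_real g))"
      by (simp add: constant_degree degree_cpoly)
    then obtain z where z: "cpoly g z = 0" using fundamental_theorem_of_algebra by blast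
    show ?thesis
    proof (cases "Im z = 0")
      case True
      then have "z = complex_of_real (Re z)" by (simp add: complex_eq_iff)
      then have root: "poly g (Re z) = 0" using z cpoly_of_real[of g "Re z"] by simp
      then have neg: "Re z < 0" using less.prems[of "Re z"] by force
      from root obtain g' where "g = [:- Re z, 1:] * g'" by (auto simp: poly_eq_0_iff_dvd)
      then show ?thesis
      proof (rule step[where k = "[:sqrt (- Re z), 1:]"])
        fix w :: real
        show "poly [:- Re z, 1:] (w\<^sup>2) = (cmod (cpoly [:sqrt (- Re z), 1:] (\<i> * complex_of_real w)))\<^sup>2"
          using neg by (simp add: map_poly_pCons cmod_power2)
      qed (use neg in auto)
    next
      case False
      let ?q = "[:(cmod z)\<^sup>2, - 2 * Re z, 1:]"
      have qz: "cpoly ?q z = 0"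
        unfolding cmod_power2 by (simp add: map_poly_pCons complex_eq_iff power2_eq_square algebra_simps)
      \<comment> \<open>The remainder is a real polynomial of degree at most 1 that vanishes at the
        non-real point z, so it is zero.\<close>
      have "degree (g mod ?q) < 2 \<or> g mod ?q = 0"
        using degree_mod_less[of ?q g] by auto
      moreover have "cpoly (g mod ?q) z = 0"
      proof -
        have "cpoly g z = cpoly (g div ?q * ?q) z + cpoly (g mod ?q) z"
          by (metis cpoly_add div_mult_mod_eq)
        then show ?thesis using z qz by (simp add: cpoly_mult del: mult_pCons_right)
      qed
      ultimately have r0: "g mod ?q = 0"
      proof (elim disjE)
        assume d: "degree (g mod ?q) < 2" and r: "cpoly (g mod ?q) z = 0"
        define c0 c1 where "c0 = coeff (g mod ?q) 0" and "c1 = coeff (g mod ?q) 1"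
        have eq: "g mod ?q = [:c0, c1:]"
        proof (rule poly_eqI)
          fix i show "coeff (g mod ?q) i = coeff [:c0, c1:] i"
            using d coeff_eq_0[of "g mod ?q" i]
            by (cases i; cases "i - 1") (auto simp: c0_def c1_def coeff_pCons split: nat.splits)
        qed
        have "complex_of_real c0 + z * complex_of_real c1 = 0"
          using r unfolding eq by (simp add: map_poly_pCons)
        then have "c1 = 0" "c0 = 0" using False by (auto simp: complex_eq_iff)
        then show ?thesis using eq by simp
      qed
      then have "g = ?q * (g div ?q)" by (metis add.right_neutral mult_div_mod_eq)
      moreover have "\<bar>Re z\<bar> < cmod z"
      proof -
        have "(cmod z)\<^sup>2 = (Re z)\<^sup>2 + (Im z)\<^sup>2" by (rule cmod_power2)
        moreover have "(Im z)\<^sup>2 > 0" using False by simp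
        ultimately have "\<bar>Re z\<bar>\<^sup>2 < (cmod z)\<^sup>2" by simp
        then show ?thesis by (rule power2_less_imp_less) simp
      qed
      ultimately show ?thesis
      proof (intro step[where k = "[:cmod z, sqrt (2 * cmod z - 2 * Re z), 1:]" and q = ?q])
        fix t :: real assume "t \<ge> 0" and *: "\<bar>Re z\<bar> < cmod z"
        have "poly ?q t = (t - Re z)\<^sup>2 + (Im z)\<^sup>2"
          unfolding cmod_power2 by (simp add: power2_eq_square algebra_simps)
        then show "poly ?q t > 0" using False by (simp add: add_nonneg_pos)
      next
        fix w :: real assume *: "\<bar>Re z\<bar> < cmod z"
        then have "sqrt (2 * cmod z - 2 * Re z) ^ 2 = 2 * cmod z - 2 * Re z" by simp
        moreover have "(cmod (cpoly [:cmod z, sqrt (2 * cmod z - 2 * Re z), 1:] (\<i> * complex_of_real w)))\<^sup>2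
          = (cmod z - w\<^sup>2)\<^sup>2 + w\<^sup>2 * sqrt (2 * cmod z - 2 * Re z) ^ 2"
          by (subst cmod_power2) (simp add: map_poly_pCons power2_eq_square algebra_simps)
        ultimately show "poly ?q (w\<^sup>2) = (cmod (cpoly [:cmod z, sqrt (2 * cmod z - 2 * Re z), 1:] (\<i> * complex_of_real w)))\<^sup>2"
          by (simp add: power2_eq_square algebra_simps)
      qed auto
    qed
  qed
qed

subsection \<open>Transfer functions of a controllable Hurwitz pair\<close>

lemma inner_transpose_mult: "(transpose M *v u) \<bullet> x = u \<bullet> (M *v x)"
  for M :: "real^'n^'n"
  by (simp add: dot_lmul_matrix)

locale hurwitz_pair =
  fixes A :: "real^'n^'n" and B :: "real^'n"
  assumes hurwitz: "hurwitz A" and controllable: "controllable A B"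
begin

section \<open>The Krylov basis B, AB, ..., A^(n-1) B\<close>

definition krylov :: "nat \<Rightarrow> real^'n" where
  "krylov k = ((\<lambda>x. A *v x) ^^ k) B"

lemma krylov_0: "krylov 0 = B"
  and krylov_Suc: "krylov (Suc k) = A *v krylov k"
  by (simp_all add: krylov_def)

lemma span_krylov: "span (krylov ` {..<CARD('n)}) = UNIV"
proof -
  have "krylov ` {..<CARD('n)} = {((\<lambda>x. A *v x) ^^ k) B | k. k < CARD('n)}"
    by (auto simp: krylov_def)
  then show ?thesis using controllable by (simp add: controllable_def)
qed

text \<open>Spanning an n-dimensional space takes at least n vectors, so the image has no
  repetitions; independence follows from the same count.\<close>

lemma card_krylov: "card (krylov ` {..<CARD('n)}) = CARD('n)"
proof -
  have "CARD('n) \<le> card (krylov ` {..<CARD('n)})"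
    using dim_le_card[of UNIV "krylov ` {..<CARD('n)}"] span_krylov by simp
  moreover have "card (krylov ` {..<CARD('n)}) \<le> CARD('n)"
    using card_image_le[of "{..<CARD('n)}" krylov] by simp
  ultimately show ?thesis by simp
qed

lemma inj_on_krylov: "inj_on krylov {..<CARD('n)}"
  by (rule eq_card_imp_inj_on) (simp_all add: card_krylov)

lemma independent_krylov: "independent (krylov ` {..<CARD('n)})"
  by (rule card_le_dim_spanning[of _ UNIV]) (simp_all add: span_krylov card_krylov)

text \<open>A linear functional may be prescribed on a basis; u is the vector that represents it.
  This realises arbitrary coefficients in \<open>numer\<close>.\<close>

lemma krylov_dual: "\<exists>u. \<forall>k<CARD('n). u \<bullet> krylov k = c k"
proof -
  let ?g = "\<lambda>x. c (the_inv_into {..<CARD('n)} krylov x)"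
  obtain f :: "real^'n \<Rightarrow> real" where f: "linear f" "\<forall>x\<in>krylov ` {..<CARD('n)}. f x = ?g x"
    using linear_independent_extend[OF independent_krylov, of ?g] by blast
  have inner: "(\<Sum>i\<in>Basis. f i *\<^sub>R i) \<bullet> x = f x" for x
  proof -
    have "f x = f (\<Sum>i\<in>Basis. (x \<bullet> i) *\<^sub>R i)" by (simp add: euclidean_representation)
    also have "\<dots> = (\<Sum>i\<in>Basis. (x \<bullet> i) * f i)"
      using f(1) by (simp add: linear_sum linear_cmul)
    finally show ?thesis by (simp add: inner_sum_left inner_commute[of x] mult.commute)
  qed
  have "(\<Sum>i\<in>Basis. f i *\<^sub>R i) \<bullet> krylov k = c k" if "k < CARD('n)" for k
    unfolding inner using f(2) inj_on_krylov that by (simp add: the_inv_into_f_f)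
  then show ?thesis by blast
qed

lemma krylov_separates:
  assumes "\<And>k. k < CARD('n) \<Longrightarrow> u \<bullet> krylov k = 0"
  shows "u = 0"
proof -
  have "span (krylov ` {..<CARD('n)}) \<subseteq> {x. u \<bullet> x = 0}"
    using assms by (intro span_minimal) (auto simp: subspace_def inner_add_right)
  then have "u \<in> {x. u \<bullet> x = 0}" using span_krylov by blast
  then show ?thesis by simp
qed

lemma B_nonzero: "B \<noteq> 0"
proof
  assume "B = 0"
  then have "krylov 0 = 0" using krylov_0 by (rule trans[rotated])
  then have "krylov k = 0" for k by (induction k) (simp_all add: krylov_Suc)
  \<comment> \<open>Some unit vector would be orthogonal to every Krylov vector;
    \<open>undefined\<close> merely names an index.\<close>
  then have "axis undefined 1 = (0 :: real^'n)" by (intro krylov_separates) simp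
  then show False by (simp add: axis_eq_0_iff)
qed

section \<open>The cyclic polynomial and the numerators of transfer functions\<close>

lemma annihilating_poly_exists:
  "\<exists>a :: real poly. degree a = CARD('n) \<and> lead_coeff a = 1 \<and>
     (\<Sum>k\<le>CARD('n). coeff a k *\<^sub>R krylov k) = 0"
proof -
  have "krylov CARD('n) \<in> span (krylov ` {..<CARD('n)})" using span_krylov by simp
  then obtain r where "krylov CARD('n) = (\<Sum>x\<in>krylov ` {..<CARD('n)}. r x *\<^sub>R x)"
    by (auto simp: span_finite)
  then have r: "krylov CARD('n) = (\<Sum>k<CARD('n). r (krylov k) *\<^sub>R krylov k)"
    using inj_on_krylov by (simp add: sum.reindex)
  define a where "a = monom 1 CARD('n) - (\<Sum>k<CARD('n). monom (r (krylov k)) k)"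
  have coeff: "coeff a i = (if i = CARD('n) then 1 else if i < CARD('n) then - r (krylov i) else 0)" for i
    by (auto simp: a_def coeff_sum coeff_monom)
  have "degree a = CARD('n)"
    by (intro antisym degree_le le_degree) (auto simp: coeff)
  moreover have "(\<Sum>k\<le>CARD('n). coeff a k *\<^sub>R krylov k) = 0"
    by (simp add: coeff r sum_negf lessThan_Suc_atMost[symmetric])
  ultimately show ?thesis using coeff by auto
qed

text \<open>Since B is a cyclic vector for A, this is the characteristic polynomial of A, obtained
  from the relation cyc(A) B = 0 without determinants.\<close>

definition cyc :: "real poly" where
  "cyc = (SOME a. degree a = CARD('n) \<and> lead_coeff a = 1 \<and>
     (\<Sum>k\<le>CARD('n). coeff a k *\<^sub>R krylov k) = 0)"

lemma degree_cyc: "degree cyc = CARD('n)"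
  and coeff_cyc_top: "coeff cyc CARD('n) = 1"
  and cyc_annihilates: "(\<Sum>k\<le>CARD('n). coeff cyc k *\<^sub>R krylov k) = 0"
  using someI_ex[OF annihilating_poly_exists] unfolding cyc_def[symmetric] by auto

text \<open>\<open>numer u / cyc\<close> is the transfer function \<open>u\<^sup>T(s - A)\<^sup>-\<^sup>1B\<close>: the coefficients of
  \<open>(a(s) - a(x)) / (s - x)\<close> as a polynomial in \<open>x\<close> are the shifts of \<open>a\<close>.\<close>
definition numer :: "real^'n \<Rightarrow> real poly" where
  "numer u = (\<Sum>k<CARD('n). smult (u \<bullet> krylov k) (poly_shift (Suc k) cyc))"

lemma coeff_numer: "coeff (numer u) i = (\<Sum>k<CARD('n). (u \<bullet> krylov k) * coeff cyc (i + Suc k))"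
  by (simp add: numer_def coeff_sum coeff_poly_shift)

lemma degree_numer: "degree (numer u) < CARD('n)"
proof -
  have "degree (numer u) \<le> CARD('n) - 1"
    by (intro degree_le) (auto simp: coeff_numer degree_cyc intro!: sum.neutral coeff_eq_0)
  then show ?thesis using zero_less_card_finite[where 'a='n] by linarith
qed

lemma numer_sum: "numer u = (\<Sum>i\<in>UNIV. smult (u $ i) (numer (axis i 1)))"
proof (rule poly_eqI)
  fix m
  have "coeff (\<Sum>i\<in>UNIV. smult (u $ i) (numer (axis i 1))) m
    = (\<Sum>i\<in>UNIV. \<Sum>k<CARD('n). u $ i * (krylov k $ i * coeff cyc (m + Suc k)))"
    by (simp add: coeff_sum coeff_numer sum_distrib_left inner_axis')
  also have "\<dots> = (\<Sum>k<CARD('n). \<Sum>i\<in>UNIV. u $ i * (krylov k $ i * coeff cyc (m + Suc k)))"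
    by (rule sum.swap)
  also have "\<dots> = coeff (numer u) m"
    by (simp add: coeff_numer inner_vec_def sum_distrib_right mult.assoc)
  finally show "coeff (numer u) m = coeff (\<Sum>i\<in>UNIV. smult (u $ i) (numer (axis i 1))) m" by simp
qed

text \<open>This is s u^T (s - A)^-1 B = u^T B + u^T A (s - A)^-1 B, multiplied by
  \<open>cyc\<close>. The coefficients agree after an index shift; the constant one vanishes because
  cyc(A) B = 0.\<close>

lemma numer_recurrence: "pCons 0 (numer u) = smult (u \<bullet> B) cyc + numer (transpose A *v u)"
proof (rule poly_eqI)
  fix i
  have "coeff (smult (u \<bullet> B) cyc + numer (transpose A *v u)) i
    = (u \<bullet> krylov 0) * coeff cyc (i + 0) + (\<Sum>k<CARD('n). (u \<bullet> krylov (Suc k)) * coeff cyc (i + Suc k))"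
    by (simp add: coeff_numer krylov_0 krylov_Suc inner_transpose_mult del: transpose_matrix_vector)
  also have "\<dots> = (\<Sum>k\<le>CARD('n). (u \<bullet> krylov k) * coeff cyc (i + k))"
    by (simp add: sum.atMost_shift)
  also have "\<dots> = coeff (pCons 0 (numer u)) i"
  proof (cases i)
    case 0
    have "(\<Sum>k\<le>CARD('n). (u \<bullet> krylov k) * coeff cyc k) = u \<bullet> (\<Sum>k\<le>CARD('n). coeff cyc k *\<^sub>R krylov k)"
      by (simp add: inner_sum_right mult.commute)
    then show ?thesis using 0 cyc_annihilates by simp
  next
    case (Suc m)
    then show ?thesis
      by (simp add: coeff_numer lessThan_Suc_atMost[symmetric] degree_cyc coeff_eq_0)
  qed
  finally show "coeff (pCons 0 (numer u)) i = coeff (smult (u \<bullet> B) cyc + numer (transpose A *v u)) i"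
    by simp
qed

text \<open>The shifts of the monic \<open>cyc\<close> are monic of the degrees n-1, ..., 0, hence a
  triangular basis of the polynomials of degree below n; \<open>krylov_dual\<close> then turns
  coordinates into a vector u.\<close>

lemma numer_surj:
  assumes "degree h < CARD('n)"
  shows "\<exists>u. numer u = h"
proof -
  have "\<exists>c. h = (\<Sum>k<CARD('n). smult (c k) (poly_shift (Suc k) cyc))"
    if "m \<le> CARD('n)" "\<And>i. i \<ge> m \<Longrightarrow> coeff h i = 0" for m and h :: "real poly"
    using that
  proof (induction m arbitrary: h)
    case (0 h)
    then have "h = 0" by (intro poly_eqI) simp
    then show ?case by (intro exI[of _ "\<lambda>_. 0"]) simp
  next
    case (Suc m h)
    \<comment> \<open>This shift of \<open>cyc\<close> is monic of degree n - (j + 1) = m, so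
      subtracting a multiple of it removes the coefficient of index m.\<close>
    define j where "j = CARD('n) - Suc m"
    have j: "j < CARD('n)" "m + Suc j = CARD('n)" using Suc.prems(1) by (auto simp: j_def)
    define h' where "h' = h - smult (coeff h m) (poly_shift (Suc j) cyc)"
    have "coeff h' i = 0" if "i \<ge> m" for i
    proof (cases "i = m")
      case True
      then show ?thesis by (simp add: h'_def coeff_poly_shift j coeff_cyc_top del: add_Suc_right)
    next
      case False
      then have "i + Suc j > CARD('n)" using that j by simp
      then show ?thesis using Suc.prems(2)[of i] False that
        by (simp add: h'_def coeff_poly_shift coeff_eq_0 degree_cyc)
    qed
    then obtain c where c: "h' = (\<Sum>k<CARD('n). smult (c k) (poly_shift (Suc k) cyc))"
      using Suc.IH[of h'] Suc.prems(1) by auto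
    have "h = h' + smult (coeff h m) (poly_shift (Suc j) cyc)" by (simp add: h'_def)
    also have "smult (coeff h m) (poly_shift (Suc j) cyc) =
      (\<Sum>k<CARD('n). smult (if k = j then coeff h m else 0) (poly_shift (Suc k) cyc))"
      using j(1) by (simp add: if_distrib[of "\<lambda>c. smult c _"] sum.delta cong: if_cong)
    finally have "h = (\<Sum>k<CARD('n). smult (c k + (if k = j then coeff h m else 0)) (poly_shift (Suc k) cyc))"
      by (simp only: c sum.distrib smult_add_left)
    then show ?case by (intro exI[of _ "\<lambda>k. c k + (if k = j then coeff h m else 0)"])
  qed
  from this[of "CARD('n)" h] obtain c where c: "h = (\<Sum>k<CARD('n). smult (c k) (poly_shift (Suc k) cyc))"
    using assms by (auto simp: coeff_eq_0)
  obtain u where "\<forall>k<CARD('n). u \<bullet> krylov k = c k" using krylov_dual by blast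
  then have "numer u = h" by (simp add: numer_def c)
  then show ?thesis ..
qed

text \<open>In classical terms this is adj(z I - A) B.\<close>

definition adj_vec :: "complex \<Rightarrow> complex^'n" where
  "adj_vec z = (\<chi> i. cpoly (numer (axis i 1)) z)"

lemma vtG_adj_vec: "vtG u (adj_vec z) = cpoly (numer u) z"
  by (subst numer_sum) (simp add: vtG_def adj_vec_def cpoly_sum cpoly_smult)

lemma mat_vec_mult: "mat z *v x = z *s (x :: complex^'n)"
  by (simp add: vec_eq_iff matrix_vector_mult_def mat_def if_distrib[of "\<lambda>c. c * _"] cong: if_cong)

lemma resolvent_adj_vec: "(mat z - cmat A) *v adj_vec z = cpoly cyc z *s cvec B"
proof -
  have "z * cpoly (numer (axis i 1)) z - (\<Sum>j\<in>UNIV. complex_of_real (A $ i $ j) * adj_vec z $ j)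
    = cpoly cyc z * complex_of_real (B $ i)" for i
  proof -
    have "(transpose A *v axis i 1) $ j = A $ i $ j" for j
      by (simp add: matrix_vector_mult_def transpose_def axis_def if_distrib[of "\<lambda>c. _ * c"]
          del: transpose_matrix_vector cong: if_cong)
    then have "(\<Sum>j\<in>UNIV. complex_of_real (A $ i $ j) * adj_vec z $ j) = vtG (transpose A *v axis i 1) (adj_vec z)"
      by (simp add: vtG_def)
    moreover have "z * cpoly (numer (axis i 1)) z = cpoly (pCons 0 (numer (axis i 1))) z"
      by (simp add: cpoly_pCons)
    ultimately show ?thesis
      by (simp add: numer_recurrence vtG_adj_vec cpoly_add cpoly_smult inner_axis' mult.commute
          del: transpose_matrix_vector)
  qed
  then show ?thesis
    by (simp add: vec_eq_iff matrix_vector_mult_diff_rdistrib mat_vec_mult)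
       (simp add: matrix_vector_mult_def cmat_def cvec_def adj_vec_def)
qed

text \<open>The numerators have no common zero, since the constant 1 is among them. Hence nothing
  cancels against a root of \<open>cyc\<close>.\<close>

lemma adj_vec_nonzero: "adj_vec z \<noteq> 0"
proof
  assume "adj_vec z = 0"
  obtain u where "numer u = 1" using numer_surj[of 1] by auto
  then have "vtG u (adj_vec z) = 1" by (simp add: vtG_adj_vec map_poly_1')
  then show False using \<open>adj_vec z = 0\<close> by (simp add: vtG_def)
qed

lemma resolvent_det: "Re z \<ge> 0 \<Longrightarrow> det (mat z - cmat A) \<noteq> 0"
  using hurwitz unfolding hurwitz_def by (meson not_less)

text \<open>At a root of \<open>cyc\<close> the nonzero vector \<open>adj_vec z\<close> would lie in
  the kernel of z I - A, which is trivial on the closed right half plane.\<close>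

lemma cyc_nonzero:
  assumes "Re z \<ge> 0"
  shows "cpoly cyc z \<noteq> 0"
proof
  assume "cpoly cyc z = 0"
  then have "(mat z - cmat A) *v adj_vec z = 0" using resolvent_adj_vec by simp
  moreover have "inj ((*v) (mat z - cmat A))"
    using resolvent_det[OF assms] by (simp add: inj_matrix_vector_mult invertible_det_nz)
  ultimately show False using adj_vec_nonzero[of z] by (metis injD matrix_vector_mult_0_right)
qed

lemma resolvent_eq:
  assumes "Re z \<ge> 0"
  shows "matrix_inv (mat z - cmat A) *v cvec B = (1 / cpoly cyc z) *s adj_vec z"
proof -
  let ?M = "mat z - cmat A"
  have inv: "matrix_inv ?M ** ?M = mat 1"
    using resolvent_det[OF assms] someI_ex[of "\<lambda>M'. ?M ** M' = mat 1 \<and> M' ** ?M = mat 1"]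
    unfolding matrix_inv_def invertible_det_nz[symmetric] invertible_def by blast
  have "cvec B = (1 / cpoly cyc z) *s (?M *v adj_vec z)"
    using cyc_nonzero[OF assms] by (simp add: resolvent_adj_vec vec_eq_iff)
  also have "\<dots> = ?M *v ((1 / cpoly cyc z) *s adj_vec z)"
    by (simp add: vector_scalar_commute)
  finally show ?thesis
    by (simp only: matrix_vector_mul_assoc inv matrix_vector_mul_lid)
qed

section \<open>Transfer functions on the closed right half plane\<close>

definition transfer :: "real^'n \<Rightarrow> complex \<Rightarrow> complex" where
  "transfer u z = cpoly (numer u) z / cpoly cyc z"

lemma vtG_Gtf: "vtG u (Gtf A B w) = transfer u (\<i> * complex_of_real w)"
  using vtG_adj_vec[of u "\<i> * complex_of_real w"]
  by (simp add: Gtf_def resolvent_eq transfer_def vtG_def flip: sum_divide_distrib)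

lemma transfer_recurrence:
  assumes "Re z \<ge> 0"
  shows "z * transfer u z = complex_of_real (u \<bullet> B) + transfer (transpose A *v u) z"
proof -
  have "z * cpoly (numer u) z = cpoly (pCons 0 (numer u)) z" by (simp add: cpoly_pCons)
  then show ?thesis
    using cyc_nonzero[OF assms] unfolding numer_recurrence
    by (simp add: transfer_def cpoly_add cpoly_smult field_simps del: transpose_matrix_vector)
qed

lemma transfer_tendsto_0: "(transfer u \<longlongrightarrow> 0) at_infinity"
  unfolding transfer_def
  by (rule poly_divide_tendsto_0_at_infinity) (simp add: degree_cpoly degree_cyc degree_numer)

lemma transfer_holomorphic: "transfer u holomorphic_on {z. Re z \<ge> 0}"
  unfolding transfer_def by (intro holomorphic_intros) (simp add: cyc_nonzero)

text \<open>Maximum principle for the negated real part on a large half disc: it is at most 0 on the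
  diameter, and decay at infinity makes it at most e on the arc.\<close>

lemma transfer_Re_nonneg:
  assumes axis: "\<And>w. Re (transfer u (\<i> * complex_of_real w)) \<ge> 0" and z: "Re z > 0"
  shows "Re (transfer u z) \<ge> 0"
proof -
  have "- Re (transfer u z) \<le> e" if "e > 0" for e
  proof -
    obtain R where R: "\<And>s. norm s \<ge> R \<Longrightarrow> norm (transfer u s) < e"
      using tendstoD[OF transfer_tendsto_0 \<open>e > 0\<close>, of u] by (auto simp: eventually_at_infinity)
    define R' where "R' = max R (norm z + 1)"
    define S where "S = {s. Re s > 0} \<inter> ball 0 R'"
    have "open S" unfolding S_def by (intro open_Int open_halfspace_Re_gt open_ball)
    have cl: "closure S \<subseteq> {s. Re s \<ge> 0} \<inter> cball 0 R'"
      unfolding S_def by (intro closure_minimal closed_Int closed_halfspace_Re_ge closed_cball) auto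
    have "Re (- transfer u z) \<le> e"
    proof (rule maximum_real_frontier[of "\<lambda>s. - transfer u s" S])
      show "(\<lambda>s. - transfer u s) holomorphic_on interior S"
        unfolding interior_open[OF \<open>open S\<close>]
        by (intro holomorphic_intros holomorphic_on_subset[OF transfer_holomorphic]) (auto simp: S_def)
      show "continuous_on (closure S) (\<lambda>s. - transfer u s)"
        using cl by (intro continuous_intros continuous_on_subset[OF holomorphic_on_imp_continuous_on[OF transfer_holomorphic]]) auto
      show "bounded S" unfolding S_def by (intro bounded_Int) simp
      show "z \<in> S" using z by (simp add: S_def R'_def)
      fix s assume "s \<in> frontier S"
      then have s: "Re s \<ge> 0" "norm s \<le> R'" "s \<notin> S"
        using cl \<open>open S\<close> by (auto simp: frontier_def interior_open)
      show "Re (- transfer u s) \<le> e"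
      proof (cases "Re s = 0")
        case True
        then have "s = \<i> * complex_of_real (Im s)" by (simp add: complex_eq_iff)
        then show ?thesis using axis[of "Im s"] \<open>e > 0\<close> by simp
      next
        case False
        then have "norm s = R'" using s by (auto simp: S_def)
        then have "norm (transfer u s) < e" using R by (simp add: R'_def)
        then show ?thesis using complex_Re_le_cmod[of "- transfer u s"] by simp
      qed
    qed
    then show ?thesis by simp
  qed
  then show ?thesis using field_le_epsilon[of "- Re (transfer u z)" 0] by simp
qed

text \<open>\<open>r * transfer u r\<close> tends to \<open>u \<bullet> B\<close> as \<open>r\<close> tends to infinity along the reals.\<close>
lemma transfer_Re_nonneg_imp_inner_B_nonneg:
  assumes "\<And>w. Re (transfer u (\<i> * complex_of_real w)) \<ge> 0"
  shows "u \<bullet> B \<ge> 0"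
proof -
  have "((\<lambda>r. transfer (transpose A *v u) (complex_of_real r)) \<longlongrightarrow> 0) at_top"
    by (rule filterlim_compose[OF transfer_tendsto_0 filterlim_of_real_at_infinity])
  then have "((\<lambda>r. Re (complex_of_real (u \<bullet> B) + transfer (transpose A *v u) (complex_of_real r))) \<longlongrightarrow> Re (complex_of_real (u \<bullet> B) + 0)) at_top"
    by (intro tendsto_intros)
  moreover have "\<forall>\<^sub>F r in at_top. 0 \<le> Re (complex_of_real (u \<bullet> B) + transfer (transpose A *v u) (complex_of_real r))"
    using eventually_gt_at_top[of 0]
  proof eventually_elim
    case (elim r)
    then have "0 \<le> Re (complex_of_real r * transfer u (complex_of_real r))"
      using transfer_Re_nonneg[OF assms, of "complex_of_real r"] by simp
    then show ?case using transfer_recurrence[of "complex_of_real r" u] elim by simp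
  qed
  ultimately show ?thesis using tendsto_lowerbound by fastforce
qed

section \<open>Real and imaginary parts of G on the imaginary axis\<close>

definition gre :: "real \<Rightarrow> real^'n" where
  "gre w = (\<chi> i. Re (Gtf A B w $ i))"

definition gim :: "real \<Rightarrow> real^'n" where
  "gim w = (\<chi> i. Im (Gtf A B w $ i))"

lemma vtG_eq: "vtG u (Gtf A B w) = Complex (u \<bullet> gre w) (u \<bullet> gim w)"
  by (simp add: vtG_def gre_def gim_def inner_vec_def complex_eq_iff)

lemma norm_Gtf: "(norm (Gtf A B w))\<^sup>2 = (norm (gre w))\<^sup>2 + (norm (gim w))\<^sup>2"
  by (simp add: norm_vec_def L2_set_def gre_def gim_def sum_nonneg cmod_power2 sum.distrib)

lemma transfer_axis: "transfer u (\<i> * complex_of_real w) = Complex (u \<bullet> gre w) (u \<bullet> gim w)"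
  by (simp add: vtG_eq flip: vtG_Gtf)

text \<open>These are the real and imaginary parts of i w G = A G + B, read off by testing against
  every u.\<close>

lemma A_gre: "A *v gre w = - (w *\<^sub>R gim w) - B" and A_gim: "A *v gim w = w *\<^sub>R gre w"
proof -
  have "u \<bullet> (A *v gre w) = u \<bullet> (- (w *\<^sub>R gim w) - B) \<and> u \<bullet> (A *v gim w) = u \<bullet> (w *\<^sub>R gre w)" for u
    using transfer_recurrence[of "\<i> * complex_of_real w" u]
    by (simp add: transfer_axis complex_eq_iff inner_transpose_mult inner_diff_right del: transpose_matrix_vector)
  then show "A *v gre w = - (w *\<^sub>R gim w) - B" "A *v gim w = w *\<^sub>R gre w"
    by (meson vector_eq_ldot)+
qed

lemma transfer_axis_tendsto_0: "((\<lambda>w. transfer u (\<i> * complex_of_real w)) \<longlongrightarrow> 0) at_top"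
proof -
  have "filterlim (\<lambda>w. \<i> * complex_of_real w) at_infinity at_top"
    by (intro tendsto_mult_filterlim_at_infinity[of _ \<i>] filterlim_of_real_at_infinity) auto
  then show ?thesis by (rule filterlim_compose[OF transfer_tendsto_0])
qed

lemma gre_tendsto_0: "((\<lambda>w. u \<bullet> gre w) \<longlongrightarrow> 0) at_top"
  using tendsto_Re[OF transfer_axis_tendsto_0[of u]] by (simp add: transfer_axis)

text \<open>Since A^2 maps \<open>gre w\<close> to -w^2 \<open>gre w\<close> - AB, pairing with u
  leaves the constant - u^T A B. The same pairing tends to 0 at infinity, so the constant is
  zero.\<close>

lemma orthogonal_gre_step:
  assumes "\<And>w. u \<bullet> gre w = 0"
  shows "u \<bullet> (A *v B) = 0" and "(transpose A *v (transpose A *v u)) \<bullet> gre w = 0"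
proof -
  have AAg: "A *v (A *v gre w) = - (w\<^sup>2 *\<^sub>R gre w) - A *v B" for w
  proof -
    have "A *v (- (w *\<^sub>R gim w) - B) = - (w *\<^sub>R (A *v gim w)) - A *v B"
      using matrix_vector_mult_scaleR[of A "- w" "gim w"]
      by (simp add: matrix_vector_mult_diff_distrib)
    then show ?thesis by (simp add: A_gre A_gim power2_eq_square)
  qed
  have AA: "(transpose A *v (transpose A *v u)) \<bullet> gre w = - (u \<bullet> (A *v B))" for w
    unfolding inner_transpose_mult AAg by (simp add: inner_diff_right assms)
  have "((\<lambda>w::real. - (u \<bullet> (A *v B))) \<longlongrightarrow> 0) at_top"
    using gre_tendsto_0[of "transpose A *v (transpose A *v u)"] unfolding AA .
  then show "u \<bullet> (A *v B) = 0" by (simp add: tendsto_const_iff)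
  then show "(transpose A *v (transpose A *v u)) \<bullet> gre w = 0" using AA by simp
qed

text \<open>The set of all such \<open>u\<close> is invariant under \<open>(A\<^sup>T)\<^sup>2\<close>, and its elements annihilate \<open>B\<close> and \<open>AB\<close>.\<close>
lemma orthogonal_gre_imp_zero:
  assumes "\<And>w. u \<bullet> gre w = 0"
  shows "u = 0"
proof -
  have *: "u \<bullet> krylov (2 * k) = 0 \<and> u \<bullet> krylov (Suc (2 * k)) = 0"
    if "\<And>w. u \<bullet> gre w = 0" for u k
    using that
  proof (induction k arbitrary: u)
    case (0 u)
    \<comment> \<open>The real part vanishes on the axis for u and for -u, so the positivity result
      applies with both signs and gives u^T B = 0.\<close>
    have "u \<bullet> B \<ge> 0" using 0 by (intro transfer_Re_nonneg_imp_inner_B_nonneg) (simp add: transfer_axis)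
    moreover have "- u \<bullet> B \<ge> 0" using 0 by (intro transfer_Re_nonneg_imp_inner_B_nonneg) (simp add: transfer_axis)
    ultimately show ?case using orthogonal_gre_step(1)[OF 0] by (simp add: krylov_0 krylov_Suc)
  next
    case (Suc k u)
    have "u \<bullet> krylov (Suc (Suc j)) = (transpose A *v (transpose A *v u)) \<bullet> krylov j" for j
      unfolding inner_transpose_mult krylov_Suc ..
    then show ?case using Suc.IH[OF orthogonal_gre_step(2)[OF Suc.prems]] by simp
  qed
  have "u \<bullet> krylov k = 0" for k
    using *[OF assms, of "k div 2"] by (cases "even k") (auto simp: odd_two_times_div_two_succ)
  then show ?thesis by (intro krylov_separates)
qed

end

subsection \<open>Quadratic forms and the Lyapunov operator\<close>

lemma symmetric_inner: "symmetric_mat M \<Longrightarrow> (M *v x) \<bullet> y = x \<bullet> (M *v y)"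
  by (metis inner_transpose_mult symmetric_mat_def)

lemma symmetric_matI: "(\<And>i j. M $ i $ j = M $ j $ i) \<Longrightarrow> symmetric_mat M"
  by (simp add: symmetric_mat_def transpose_def vec_eq_iff)

lemma outer_mult_vec: "outer x y *v z = (y \<bullet> z) *\<^sub>R x"
  by (simp add: vec_eq_iff matrix_vector_mult_def outer_def inner_vec_def sum_distrib_left mult_ac)

lemma scaleR_matrix_vector: "(c *\<^sub>R M) *v x = c *\<^sub>R (M *v x)" for M :: "real^'n^'m"
  by (simp add: vec_eq_iff matrix_vector_mult_def sum_distrib_left mult_ac)

text \<open>If y = N x were nonzero, a short step from x in the direction -y would make the
  quadratic form negative.\<close>

lemma psd_kernel:
  fixes N :: "real^'n^'n"
  assumes sym: "symmetric_mat N" and psd: "\<And>y. y \<bullet> (N *v y) \<ge> 0" and x: "x \<bullet> (N *v x) = 0"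
  shows "N *v x = 0"
proof (rule ccontr)
  assume "N *v x \<noteq> 0"
  define y where "y = N *v x"
  define b where "b = y \<bullet> (N *v y)"
  \<comment> \<open>With this step size s b < 1, so the linear decrease dominates the quadratic
    term.\<close>
  define s where "s = 1 / (b + 1)"
  have b: "b \<ge> 0" and s: "s > 0" "s * b < 1" using psd by (auto simp: b_def s_def add_nonneg_pos)
  have pos: "y \<bullet> y > 0" using \<open>N *v x \<noteq> 0\<close> by (simp add: y_def)
  define t where "t = s * (y \<bullet> y)"
  have "(x - t *\<^sub>R y) \<bullet> (N *v (x - t *\<^sub>R y)) = - 2 * t * (y \<bullet> y) + t\<^sup>2 * b"
    using symmetric_inner[OF sym, of x y] x
    by (simp add: matrix_vector_mult_diff_distrib matrix_vector_mult_scaleR inner_diff_left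
        inner_diff_right y_def[symmetric] b_def power2_eq_square right_diff_distrib)
  also have "\<dots> = t * (y \<bullet> y) * (s * b - 2)" by (simp add: t_def power2_eq_square algebra_simps)
  also have "\<dots> < 0" using s pos by (intro mult_pos_neg) (auto simp: t_def)
  finally show False using psd[of "x - t *\<^sub>R y"] by simp
qed

text \<open>Eigenvectors for distinct eigenvalues are orthogonal, hence independent. Finiteness is
  what gives the \<open>Min\<close> in \<open>lambda_min\<close> its meaning.\<close>

lemma finite_symmetric_eigenvalues:
  fixes M :: "real^'n^'n"
  assumes sym: "symmetric_mat M"
  shows "finite {e. \<exists>x. x \<noteq> 0 \<and> M *v x = e *\<^sub>R x}" (is "finite ?E")
proof -
  obtain ev where ev: "\<And>e. e \<in> ?E \<Longrightarrow> ev e \<noteq> 0 \<and> M *v ev e = e *\<^sub>R ev e"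
    using bchoice[of ?E "\<lambda>e x. x \<noteq> 0 \<and> M *v x = e *\<^sub>R x"] by blast
  have orth: "ev e \<bullet> ev e' = 0" if "e \<in> ?E" "e' \<in> ?E" "e \<noteq> e'" for e e'
  proof -
    have "e * (ev e \<bullet> ev e') = e' * (ev e \<bullet> ev e')"
      using symmetric_inner[OF sym, of "ev e" "ev e'"] ev[OF that(1)] ev[OF that(2)] by simp
    then show ?thesis using that(3) by simp
  qed
  have "inj_on ev ?E"
  proof (rule inj_onI, rule ccontr)
    fix e e' assume *: "e \<in> ?E" "e' \<in> ?E" "ev e = ev e'" "e \<noteq> e'"
    then show False using orth[OF *(1,2,4)] ev[OF *(1)] by simp
  qed
  moreover have "finite (ev ` ?E)"
  proof (rule independent_imp_finite, rule pairwise_orthogonal_independent)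
    show "pairwise orthogonal (ev ` ?E)"
      by (auto simp: pairwise_def orthogonal_def intro!: orth)
    show "0 \<notin> ev ` ?E" using ev by force
  qed
  ultimately show ?thesis using finite_imageD by blast
qed

text \<open>Rayleigh's argument: let mu be the minimum of the form on the unit sphere, attained at
  x0. Then M - mu I is positive semidefinite with zero form at x0, so \<open>psd_kernel\<close>
  makes x0 an eigenvector.\<close>

lemma lambda_min_props:
  fixes M :: "real^'n^'n"
  assumes sym: "symmetric_mat M"
  shows "lambda_min M * (norm x)\<^sup>2 \<le> x \<bullet> (M *v x)"
    and "\<exists>x. x \<noteq> 0 \<and> M *v x = lambda_min M *\<^sub>R x"
proof -
  have "continuous_on (sphere 0 1) (\<lambda>x. x \<bullet> (M *v x))"
    by (intro continuous_intros linear_continuous_on_compose[of _ _ "(*v) M"]) auto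
  moreover have "sphere 0 1 \<noteq> ({} :: (real^'n) set)" by simp
  ultimately obtain x0 where x0: "norm x0 = 1" "\<And>y. norm y = 1 \<Longrightarrow> x0 \<bullet> (M *v x0) \<le> y \<bullet> (M *v y)"
    using continuous_attains_inf[OF compact_sphere, of 0 1 "\<lambda>x. x \<bullet> (M *v x)"] by auto
  define \<mu> where "\<mu> = x0 \<bullet> (M *v x0)"
  have ray: "\<mu> * (norm x)\<^sup>2 \<le> x \<bullet> (M *v x)" for x
  proof (cases "x = 0")
    case False
    have "\<mu> \<le> (x /\<^sub>R norm x) \<bullet> (M *v (x /\<^sub>R norm x))"
      using x0(2)[of "x /\<^sub>R norm x"] False by (simp add: \<mu>_def)
    then show ?thesis
      using False by (simp add: matrix_vector_mult_scaleR field_simps power2_eq_square)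
  qed simp
  have "(M - \<mu> *\<^sub>R mat 1) *v x0 = 0"
  proof (rule psd_kernel)
    show "symmetric_mat (M - \<mu> *\<^sub>R mat 1)"
      using sym by (auto simp: symmetric_mat_def transpose_def vec_eq_iff mat_def)
    show "y \<bullet> ((M - \<mu> *\<^sub>R mat 1) *v y) \<ge> 0" for y
      using ray[of y] by (simp add: matrix_vector_mult_diff_rdistrib scaleR_matrix_vector
          inner_diff_right dot_square_norm)
    show "x0 \<bullet> ((M - \<mu> *\<^sub>R mat 1) *v x0) = 0"
      using x0(1) by (simp add: matrix_vector_mult_diff_rdistrib scaleR_matrix_vector
          inner_diff_right dot_square_norm \<mu>_def)
  qed
  then have eig: "M *v x0 = \<mu> *\<^sub>R x0"
    by (simp add: matrix_vector_mult_diff_rdistrib scaleR_matrix_vector)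
  have "x0 \<noteq> 0" using x0(1) by auto
  have "lambda_min M = \<mu>"
    unfolding lambda_min_def
  proof (rule Min_eqI[OF finite_symmetric_eigenvalues[OF sym]])
    show "\<mu> \<in> {e. \<exists>x. x \<noteq> 0 \<and> M *v x = e *\<^sub>R x}" using eig \<open>x0 \<noteq> 0\<close> by blast
    fix e assume "e \<in> {e. \<exists>x. x \<noteq> 0 \<and> M *v x = e *\<^sub>R x}"
    then obtain x where "x \<noteq> 0" "M *v x = e *\<^sub>R x" by blast
    then show "\<mu> \<le> e" using ray[of x] by (simp add: dot_square_norm)
  qed
  then show "lambda_min M * (norm x)\<^sup>2 \<le> x \<bullet> (M *v x)"
    and "\<exists>x. x \<noteq> 0 \<and> M *v x = lambda_min M *\<^sub>R x"
    using ray eig \<open>x0 \<noteq> 0\<close> by auto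
qed

section \<open>The Lyapunov operator and the LMI as a quadratic inequality\<close>

definition lyap :: "real^'n^'n \<Rightarrow> real^'n^'n \<Rightarrow> real^'n^'n" where
  "lyap A P = transpose A ** P + P ** A"

lemma linear_lyap: "linear (lyap A)"
  by (rule linearI)
    (simp_all add: lyap_def vec_eq_iff matrix_matrix_mult_def sum_distrib_left sum.distrib algebra_simps)

lemma symmetric_lyap: "symmetric_mat P \<Longrightarrow> symmetric_mat (lyap A P)"
  unfolding symmetric_mat_def lyap_def
  by (simp add: vec_eq_iff transpose_def matrix_matrix_mult_def mult.commute add.commute)

lemma lyap_quadratic:
  assumes "symmetric_mat P"
  shows "x \<bullet> (lyap A P *v x) = 2 * ((P *v x) \<bullet> (A *v x))"
proof -
  have "x \<bullet> (lyap A P *v x) = x \<bullet> (transpose A *v (P *v x)) + x \<bullet> (P *v (A *v x))"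
    by (simp only: lyap_def matrix_vector_mult_add_rdistrib matrix_vector_mul_assoc[symmetric] inner_add_right)
  also have "x \<bullet> (transpose A *v (P *v x)) = (P *v x) \<bullet> (A *v x)"
    by (metis inner_commute inner_transpose_mult)
  also have "x \<bullet> (P *v (A *v x)) = (P *v x) \<bullet> (A *v x)"
    by (simp add: symmetric_inner[OF assms])
  finally show ?thesis by simp
qed

lemma LMI_iff:
  "LMI A B v \<kappa> \<psi> P \<longleftrightarrow> symmetric_mat P \<and> P *v B = v \<and>
     (\<forall>x. x \<bullet> (lyap A P *v x) \<le> \<kappa> * (v \<bullet> x)\<^sup>2 - (\<psi> + \<kappa> * (norm v)\<^sup>2) * (norm x)\<^sup>2)"
proof -
  have eq: "x \<bullet> ((transpose A ** P + P ** A + (\<psi> + \<kappa> * (norm v)\<^sup>2) *\<^sub>R mat 1 - \<kappa> *\<^sub>R outer v v) *v x)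
    = x \<bullet> (lyap A P *v x) + (\<psi> + \<kappa> * (norm v)\<^sup>2) * (norm x)\<^sup>2 - \<kappa> * (v \<bullet> x)\<^sup>2" for x
    unfolding lyap_def[symmetric]
    by (simp only: matrix_vector_mult_diff_rdistrib matrix_vector_mult_add_rdistrib
        scaleR_matrix_vector inner_diff_right inner_add_right outer_mult_vec)
      (simp add: dot_square_norm power2_eq_square inner_commute)
  show ?thesis unfolding LMI_def neg_semidef_def eq by (auto simp: le_diff_eq diff_le_eq)
qed

context hurwitz_pair
begin

text \<open>The two terms carrying the factor w cancel because P is symmetric; only the contribution
  of B in \<open>A_gre\<close> survives.\<close>

lemma lyap_frequency:
  assumes sym: "symmetric_mat P"
  shows "gre w \<bullet> (lyap A P *v gre w) + gim w \<bullet> (lyap A P *v gim w) = - 2 * ((P *v B) \<bullet> gre w)"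
  using symmetric_inner[OF sym, of "gre w" "gim w"] symmetric_inner[OF sym, of B "gre w"]
  by (simp add: lyap_quadratic[OF sym] A_gre A_gim inner_diff_right inner_commute[of "P *v gre w" B]
      inner_commute[of "P *v gim w" "gre w"])

text \<open>If \<open>A\<^sup>TP + PA = 0\<close>, then \<open>PA\<^sup>kB = (-A\<^sup>T)\<^sup>kPB\<close>, so it is enough that \<open>PB = 0\<close>.\<close>
lemma lyap_kernel:
  assumes sym: "symmetric_mat P" and zero: "lyap A P = 0"
  shows "P = 0"
proof -
  have "(P *v B) \<bullet> gre w = 0" for w using lyap_frequency[OF sym, of w] zero by simp
  then have PB: "P *v B = 0" by (rule orthogonal_gre_imp_zero)
  have PA: "P *v (A *v x) = - (transpose A *v (P *v x))" for x
  proof -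
    have "lyap A P *v x = transpose A *v (P *v x) + P *v (A *v x)"
      by (simp only: lyap_def matrix_vector_mult_add_rdistrib matrix_vector_mul_assoc[symmetric])
    then show ?thesis using zero by (simp add: eq_neg_iff_add_eq_0 add.commute)
  qed
  have "P *v krylov k = 0" for k
    by (induction k) (simp_all add: krylov_0 krylov_Suc PB PA del: transpose_matrix_vector)
  then have "span (krylov ` {..<CARD('n)}) \<subseteq> {x. P *v x = 0}"
    by (intro span_minimal) (auto simp: subspace_def matrix_vector_right_distrib matrix_vector_mult_scaleR)
  then have "\<forall>x. P *v x = 0 *v x" unfolding span_krylov by auto
  then show ?thesis unfolding matrix_eq .
qed

text \<open>The operator maps the finite-dimensional space of symmetric matrices into itself and is
  injective there, hence surjective; no matrix exponential integral is involved.\<close>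

lemma lyap_solvable:
  assumes "symmetric_mat W"
  shows "\<exists>P. symmetric_mat P \<and> lyap A P = W"
proof -
  let ?S = "{P :: real^'n^'n. symmetric_mat P}"
  have S: "subspace ?S"
    by (auto simp: subspace_def symmetric_mat_def transpose_def vec_eq_iff)
  have "inj_on (lyap A) ?S"
    unfolding linear_inj_on_iff_eq_0[OF linear_lyap S] using lyap_kernel by blast
  then have "dim (lyap A ` ?S) = dim ?S"
    using span_eq_iff[THEN iffD2, OF S] by (intro dim_image_eq linear_lyap) (simp only:)
  moreover have "lyap A ` ?S \<subseteq> ?S" using symmetric_lyap by blast
  ultimately have "lyap A ` ?S = ?S"
    by (intro subspace_dim_equal linear_subspace_image linear_lyap S) auto
  then show ?thesis using assms by (metis (no_types, lifting) imageE mem_Collect_eq)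
qed

lemma lyap_B_nonneg:
  assumes "symmetric_mat P" "\<And>x. x \<bullet> (lyap A P *v x) \<le> 0"
  shows "B \<bullet> (P *v B) \<ge> 0"
proof -
  have "(P *v B) \<bullet> gre w \<ge> 0" for w
    using lyap_frequency[OF assms(1), of w] assms(2)[of "gre w"] assms(2)[of "gim w"] by simp
  then have "(P *v B) \<bullet> B \<ge> 0"
    by (intro transfer_Re_nonneg_imp_inner_B_nonneg) (simp add: transfer_axis)
  then show ?thesis by (simp add: inner_commute)
qed

text \<open>The vectors C B with C commuting with A form a subspace, and C = A^k shows that it
  contains the Krylov basis.\<close>

lemma commutant_orbit: "\<exists>C. A ** C = C ** A \<and> C *v B = x"
proof -
  let ?V = "{x. \<exists>C. A ** C = C ** A \<and> C *v B = x}"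
  have "A ** 0 = 0 ** A \<and> 0 *v B = 0"
    by (simp add: matrix_eq matrix_vector_mul_assoc[symmetric])
  moreover have "\<exists>E. A ** E = E ** A \<and> E *v B = C *v B + D *v B"
    if "A ** C = C ** A" "A ** D = D ** A" for C D
    using that by (intro exI[of _ "C + D"])
      (simp add: matrix_eq matrix_vector_mul_assoc[symmetric] matrix_vector_mult_add_rdistrib
        matrix_vector_right_distrib)
  moreover have "\<exists>E. A ** E = E ** A \<and> E *v B = c *\<^sub>R (C *v B)" if "A ** C = C ** A" for C c
  proof (intro exI conjI)
    show "A ** (c *\<^sub>R C) = (c *\<^sub>R C) ** A"
      using that by (simp add: matrix_eq matrix_vector_mul_assoc[symmetric] scaleR_matrix_vector
          matrix_vector_mult_scaleR)
  qed (rule scaleR_matrix_vector)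
  ultimately have "subspace ?V" unfolding subspace_def by blast
  moreover have "krylov k \<in> ?V" for k
  proof (induction k)
    case 0
    have "A ** mat 1 = mat 1 ** A \<and> mat 1 *v B = B" by simp
    then show ?case unfolding krylov_0 by blast
  next
    case (Suc k)
    then obtain C where C: "A ** C = C ** A" "C *v B = krylov k" by blast
    have "A ** (A ** C) = (A ** C) ** A" by (metis C(1) matrix_mul_assoc)
    moreover have "(A ** C) *v B = krylov (Suc k)"
      by (simp add: krylov_Suc C(2) flip: matrix_vector_mul_assoc)
    ultimately show ?case by blast
  qed
  ultimately have "span (krylov ` {..<CARD('n)}) \<subseteq> ?V" by (intro span_minimal) auto
  then have "x \<in> ?V" unfolding span_krylov by blast
  then show ?thesis by simp
qed

text \<open>Replacing \<open>P\<close> by \<open>C\<^sup>TPC\<close> with \<open>C\<close> commuting with \<open>A\<close> preserves the Lyapunov inequality, so the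
  case \<open>x = B\<close> suffices.\<close>
lemma lyap_nonneg:
  assumes sym: "symmetric_mat P" and neg: "\<And>x. x \<bullet> (lyap A P *v x) \<le> 0"
  shows "x \<bullet> (P *v x) \<ge> 0"
proof -
  obtain C where C: "A ** C = C ** A" "C *v B = x" using commutant_orbit by blast
  define P' where "P' = transpose C ** P ** C"
  have P': "(P' *v y) \<bullet> z = (P *v (C *v y)) \<bullet> (C *v z)" for y z
    unfolding P'_def matrix_vector_mul_assoc[symmetric] by (rule inner_transpose_mult)
  have sym': "symmetric_mat P'"
    using sym unfolding symmetric_mat_def P'_def
    by (simp add: matrix_transpose_mul matrix_mul_assoc)
  have "B \<bullet> (P' *v B) \<ge> 0"
  proof (rule lyap_B_nonneg[OF sym'])
    fix y
    have "C *v (A *v y) = A *v (C *v y)" using C(1) by (metis matrix_vector_mul_assoc)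
    then have "y \<bullet> (lyap A P' *v y) = (C *v y) \<bullet> (lyap A P *v (C *v y))"
      by (simp add: lyap_quadratic[OF sym'] lyap_quadratic[OF sym] P')
    then show "y \<bullet> (lyap A P' *v y) \<le> 0" using neg by simp
  qed
  then show ?thesis using P'[of B B] C(2) by (simp add: inner_commute)
qed

text \<open>P is already positive semidefinite. A zero of its form would give P x = 0 by
  \<open>psd_kernel\<close>, and then the Lyapunov form 2 (P x)^T A x would vanish at x as
  well.\<close>

lemma lyap_pos_def:
  assumes sym: "symmetric_mat P" and neg: "\<And>x. x \<noteq> 0 \<Longrightarrow> x \<bullet> (lyap A P *v x) < 0"
  shows "pos_def P"
  unfolding pos_def_def
proof (intro allI impI)
  fix x :: "real^'n" assume "x \<noteq> 0"
  have nonneg: "y \<bullet> (P *v y) \<ge> 0" for y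
  proof (rule lyap_nonneg[OF sym])
    fix z show "z \<bullet> (lyap A P *v z) \<le> 0" using neg[of z] by (cases "z = 0") auto
  qed
  have "P *v x \<noteq> 0" using neg[OF \<open>x \<noteq> 0\<close>] by (auto simp: lyap_quadratic[OF sym])
  then show "x \<bullet> (P *v x) > 0"
    using psd_kernel[OF sym nonneg, of x] nonneg[of x] by force
qed

section \<open>The frequency function and its behaviour at infinity\<close>

lemma ffun_eq:
  "ffun A B w \<kappa> \<theta> v = 2 * (v \<bullet> gre w) + \<kappa> * ((v \<bullet> gre w)\<^sup>2 + (v \<bullet> gim w)\<^sup>2)
     - \<theta> * ((norm (gre w))\<^sup>2 + (norm (gim w))\<^sup>2)"
  by (simp add: ffun_def vtG_eq norm_Gtf cmod_power2)

lemma norm_Gtf_pos: "(norm (Gtf A B w))\<^sup>2 > 0"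
proof -
  have "gre w \<noteq> 0 \<or> gim w \<noteq> 0"
    using A_gre[of w] B_nonzero by auto
  then show ?thesis unfolding norm_Gtf by (auto intro: add_pos_nonneg add_nonneg_pos)
qed

text \<open>The LMI is evaluated at \<open>gre w\<close> and \<open>gim w\<close> and summed;
  \<open>P *v B = v\<close> turns the Lyapunov side into the linear term of f.\<close>

lemma LMI_imp_ffun_ge:
  assumes "LMI A B v \<kappa> \<psi> P"
  shows "ffun A B w \<kappa> (\<kappa> * (norm v)\<^sup>2) v \<ge> \<psi> * (norm (Gtf A B w))\<^sup>2"
proof -
  from assms have sym: "symmetric_mat P" and PB: "P *v B = v"
    and le: "\<And>x. x \<bullet> (lyap A P *v x) \<le> \<kappa> * (v \<bullet> x)\<^sup>2 - (\<psi> + \<kappa> * (norm v)\<^sup>2) * (norm x)\<^sup>2"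
    by (auto simp: LMI_iff)
  show ?thesis
    using lyap_frequency[OF sym, of w] le[of "gre w"] le[of "gim w"]
    by (simp add: ffun_eq norm_Gtf PB algebra_simps)
qed

lemma gre_vec_tendsto: "(gre \<longlongrightarrow> 0) at_top" and gim_vec_tendsto: "(gim \<longlongrightarrow> 0) at_top"
proof -
  have "((\<lambda>w. gre w $ i) \<longlongrightarrow> 0 $ i) at_top" "((\<lambda>w. gim w $ i) \<longlongrightarrow> 0 $ i) at_top" for i
    using tendsto_Re[OF transfer_axis_tendsto_0[of "axis i 1"]] tendsto_Im[OF transfer_axis_tendsto_0[of "axis i 1"]]
    by (simp_all add: transfer_axis inner_axis')
  then show "(gre \<longlongrightarrow> 0) at_top" "(gim \<longlongrightarrow> 0) at_top" by (auto intro: vec_tendstoI)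
qed

text \<open>Numerator and denominator both decay like w^-2, so both are multiplied by w^2. The
  rescaled vectors w \<open>gre\<close>, w \<open>gim\<close> and w^2 \<open>gre\<close> converge
  because \<open>A_gre\<close> and \<open>A_gim\<close> express them through A; the denominator
  tends to |B|^2, which is not 0. The limit thus exists without any sign condition.\<close>

lemma ffun_quotient_convergent:
  "\<exists>L. ((\<lambda>w. ffun A B w \<kappa> \<theta> v / (norm (Gtf A B w))\<^sup>2) \<longlongrightarrow> L) at_top"
proof -
  \<comment> \<open>The linear term has its own slot z because it needs the factor w^2, whereas the
    vectors in the quadratic terms are scaled by w only.\<close>
  define num where "num = (\<lambda>x y z. 2 * (v \<bullet> z) + \<kappa> * ((v \<bullet> x)\<^sup>2 + (v \<bullet> y)\<^sup>2) - \<theta> * ((norm x)\<^sup>2 + (norm y)\<^sup>2))"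
  let ?x = "\<lambda>w. A *v gim w" and ?y = "\<lambda>w. - (A *v gre w) - B" and ?z = "\<lambda>w. A *v (- (A *v gre w) - B)"
  have lin: "((\<lambda>w. A *v f w) \<longlongrightarrow> A *v l) at_top" if "(f \<longlongrightarrow> l) at_top" for f l
    by (rule bounded_linear.tendsto[OF matrix_vector_mul_bounded_linear that])
  have x: "(?x \<longlongrightarrow> 0) at_top"
    using lin[OF gim_vec_tendsto] by simp
  have y: "(?y \<longlongrightarrow> - B) at_top"
    using tendsto_diff[OF tendsto_minus[OF lin[OF gre_vec_tendsto]] tendsto_const[of B]] by simp
  have z: "(?z \<longlongrightarrow> A *v (- B)) at_top" by (rule lin[OF y])
  have "((\<lambda>w. num (f w) (g w) (h w) / ((norm (f w))\<^sup>2 + (norm (g w))\<^sup>2)) \<longlongrightarrow>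
     num a b c / ((norm a)\<^sup>2 + (norm b)\<^sup>2)) at_top"
    if "(f \<longlongrightarrow> a) at_top" "(g \<longlongrightarrow> b) at_top" "(h \<longlongrightarrow> c) at_top"
      "(norm a)\<^sup>2 + (norm b)\<^sup>2 \<noteq> 0" for f g h :: "real \<Rightarrow> real^'n" and a b c
    unfolding num_def by (intro tendsto_intros that)
  from this[OF x y z]
  have "((\<lambda>w. num (?x w) (?y w) (?z w) / ((norm (?x w))\<^sup>2 + (norm (?y w))\<^sup>2)) \<longlongrightarrow>
     num 0 (- B) (A *v (- B)) / ((norm (0 :: real^'n))\<^sup>2 + (norm (- B))\<^sup>2)) at_top"
    using B_nonzero by simp
  moreover have "\<forall>\<^sub>F w in at_top. num (?x w) (?y w) (?z w) / ((norm (?x w))\<^sup>2 + (norm (?y w))\<^sup>2)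
     = ffun A B w \<kappa> \<theta> v / (norm (Gtf A B w))\<^sup>2"
    using eventually_gt_at_top[of 0]
  proof eventually_elim
    case (elim w)
    have y: "?y w = w *\<^sub>R gim w" by (simp add: A_gre)
    have z: "A *v (w *\<^sub>R gim w) = w\<^sup>2 *\<^sub>R gre w" by (simp add: matrix_vector_mult_scaleR A_gim power2_eq_square)
    have "num (?x w) (?y w) (?z w) = w\<^sup>2 * ffun A B w \<kappa> \<theta> v"
      unfolding y z A_gim num_def ffun_eq by (simp add: power_mult_distrib algebra_simps)
    moreover have "(norm (?x w))\<^sup>2 + (norm (?y w))\<^sup>2 = w\<^sup>2 * (norm (Gtf A B w))\<^sup>2"
      unfolding y A_gim norm_Gtf by (simp add: power_mult_distrib algebra_simps)
    ultimately show ?case using elim by (simp only: mult_divide_mult_cancel_left_if) simp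
  qed
  ultimately show ?thesis by (intro exI) (rule Lim_transform_eventually)
qed

lemma continuous_gre: "continuous_on UNIV gre" and continuous_gim: "continuous_on UNIV gim"
proof -
  have "continuous_on UNIV (\<lambda>w. transfer u (\<i> * complex_of_real w))" for u
    by (rule continuous_on_compose2[OF holomorphic_on_imp_continuous_on[OF transfer_holomorphic]])
      (auto intro!: continuous_intros)
  from continuous_on_Re[OF this] continuous_on_Im[OF this]
  have c: "continuous_on UNIV (\<lambda>w. u \<bullet> gre w)" "continuous_on UNIV (\<lambda>w. u \<bullet> gim w)" for u
    by (simp_all add: transfer_axis)
  have "(\<lambda>w. \<chi> i. axis i 1 \<bullet> gre w) = gre" "(\<lambda>w. \<chi> i. axis i 1 \<bullet> gim w) = gim"
    by (simp_all add: inner_axis' fun_eq_iff)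
  moreover have "continuous_on UNIV (\<lambda>w. \<chi> i. axis i 1 \<bullet> gre w)"
    "continuous_on UNIV (\<lambda>w. \<chi> i. axis i 1 \<bullet> gim w)"
    by (intro continuous_on_vec_lambda c)+
  ultimately show "continuous_on UNIV gre" "continuous_on UNIV gim" by (simp_all only:)
qed

text \<open>G(-i w) is the conjugate of G(i w). This carries the limit condition at +infinity over
  to negative frequencies.\<close>

lemma gre_even: "gre (- w) = gre w" and gim_odd: "gim (- w) = - gim w"
proof -
  have "transfer u (\<i> * complex_of_real (- w)) = cnj (transfer u (\<i> * complex_of_real w))" for u
    by (simp add: transfer_def cnj_cpoly)
  then have "u \<bullet> gre (- w) = u \<bullet> gre w \<and> u \<bullet> gim (- w) = u \<bullet> (- gim w)" for u
    unfolding transfer_axis by (simp add: complex_eq_iff)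
  then show "gre (- w) = gre w" "gim (- w) = - gim w" by (meson vector_eq_ldot)+
qed

text \<open>The quotient is continuous and positive, hence bounded away from 0 on a compact
  interval, and it exceeds L/2 beyond it; evenness covers negative w.\<close>

lemma uniform_margin:
  assumes pos: "\<And>w. ffun A B w \<kappa> \<theta> v > 0"
    and lim: "((\<lambda>w. ffun A B w \<kappa> \<theta> v / (norm (Gtf A B w))\<^sup>2) \<longlongrightarrow> L) at_top" and "L > 0"
  shows "\<exists>\<psi>>0. \<forall>w. ffun A B w \<kappa> \<theta> v > \<psi> * (norm (Gtf A B w))\<^sup>2"
proof -
  define r where "r = (\<lambda>w. ffun A B w \<kappa> \<theta> v / (norm (Gtf A B w))\<^sup>2)"
  have r_pos: "r w > 0" for w unfolding r_def using pos norm_Gtf_pos by (intro divide_pos_pos)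
  have r_even: "r (- w) = r w" for w
    by (simp add: r_def ffun_eq norm_Gtf gre_even gim_odd)
  obtain W where W: "\<And>w. w \<ge> W \<Longrightarrow> r w > L / 2"
    using order_tendstoD(1)[OF lim, of "L / 2"] \<open>L > 0\<close> unfolding r_def eventually_at_top_linorder by auto
  have "continuous_on {0..\<bar>W\<bar>} r"
    using norm_Gtf_pos unfolding r_def ffun_eq norm_Gtf
    by (intro continuous_intros continuous_on_subset[OF continuous_gre] continuous_on_subset[OF continuous_gim])
      (auto simp: less_le)
  then obtain m where m: "\<forall>w\<in>{0..\<bar>W\<bar>}. r m \<le> r w"
    using continuous_attains_inf[of "{0..\<bar>W\<bar>}" r] by auto
  \<comment> \<open>The outer halving puts the margin strictly below both lower bounds.\<close>
  define \<psi> where "\<psi> = min (L / 2) (r m) / 2"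
  have \<psi>: "\<psi> > 0" "\<psi> < L / 2" "\<psi> < r m" using \<open>L > 0\<close> r_pos[of m] by (auto simp: \<psi>_def)
  have "r \<bar>w\<bar> > \<psi>" for w
  proof (cases "\<bar>w\<bar> \<le> \<bar>W\<bar>")
    case True
    then show ?thesis using \<psi>(3) bspec[OF m, of "\<bar>w\<bar>"] by simp
  next
    case False
    then have "W \<le> \<bar>w\<bar>" by linarith
    then show ?thesis using \<psi>(2) W[of "\<bar>w\<bar>"] by simp
  qed
  then have "r w > \<psi>" for w using r_even[of w] by (metis abs_if)
  then have "\<forall>w. ffun A B w \<kappa> \<theta> v > \<psi> * (norm (Gtf A B w))\<^sup>2"
    using norm_Gtf_pos by (simp add: r_def less_divide_eq)
  then show ?thesis using \<psi>(1) by blast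
qed

text \<open>Multiplied by |cyc|^2, f becomes a positive polynomial in w^2 of degree below n. Its
  spectral factor also has degree below n, so it is the numerator of a transfer function by
  \<open>numer_surj\<close>.\<close>

lemma frequency_spectral_factor:
  assumes pos: "\<And>w. ffun A B w \<kappa> \<theta> v > 0"
  shows "\<exists>l. \<forall>w. ffun A B w \<kappa> \<theta> v = (l \<bullet> gre w)\<^sup>2 + (l \<bullet> gim w)\<^sup>2"
proof -
  let ?a = "\<lambda>w. cpoly cyc (\<i> * complex_of_real w)"
  have a: "?a w \<noteq> 0" for w by (rule cyc_nonzero) simp
  have num: "cpoly (numer u) (\<i> * complex_of_real w) = ?a w * Complex (u \<bullet> gre w) (u \<bullet> gim w)" for u w
    using a[of w] by (simp add: transfer_axis[symmetric] transfer_def)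
  obtain g1 where g1: "2 * degree g1 \<le> degree (numer v) + degree cyc"
    "\<And>w. Re (cpoly (numer v) (\<i> * complex_of_real w) * cnj (?a w)) = poly g1 (w\<^sup>2)"
    using even_part_poly by blast
  obtain g where g: "\<And>u. 2 * degree (g u) \<le> degree (numer u) + degree (numer u)"
    "\<And>u w. Re (cpoly (numer u) (\<i> * complex_of_real w) * cnj (cpoly (numer u) (\<i> * complex_of_real w))) = poly (g u) (w\<^sup>2)"
    using even_part_poly[of "numer u" "numer u" for u] by metis
  have cmod: "Re (z * cnj z) = (cmod z)\<^sup>2" for z
    unfolding cmod_power2 by (simp add: power2_eq_square)
  have p1: "poly g1 (w\<^sup>2) = (cmod (?a w))\<^sup>2 * (v \<bullet> gre w)" for w
    unfolding g1(2)[symmetric] num cmod_power2 by (simp add: power2_eq_square algebra_simps)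
  have pg: "poly (g u) (w\<^sup>2) = (cmod (?a w))\<^sup>2 * ((u \<bullet> gre w)\<^sup>2 + (u \<bullet> gim w)\<^sup>2)" for u w
    unfolding g(2)[symmetric] cmod num by (simp add: norm_mult power_mult_distrib cmod_power2[of "Complex _ _"])
  define G where "G = smult 2 g1 + smult \<kappa> (g v) - smult \<theta> (\<Sum>i\<in>UNIV. g (axis i 1))"
  have pG: "poly G (w\<^sup>2) = (cmod (?a w))\<^sup>2 * ffun A B w \<kappa> \<theta> v" for w
  proof -
    have "(norm x)\<^sup>2 = (\<Sum>i\<in>UNIV. (x $ i)\<^sup>2)" for x :: "real^'n"
      by (simp add: norm_vec_def L2_set_def sum_nonneg)
    then have "poly (\<Sum>i\<in>UNIV. g (axis i 1)) (w\<^sup>2) = (cmod (?a w))\<^sup>2 * ((norm (gre w))\<^sup>2 + (norm (gim w))\<^sup>2)"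
      by (simp add: poly_sum pg inner_axis' sum.distrib flip: sum_distrib_left)
    then show ?thesis by (simp add: G_def p1 pg ffun_eq algebra_simps)
  qed
  have "poly G t > 0" if "t \<ge> 0" for t
    using pG[of "sqrt t"] pos[of "sqrt t"] a[of "sqrt t"] that by simp
  then obtain h where h: "degree h \<le> degree G" "\<And>w. poly G (w\<^sup>2) = (cmod (cpoly h (\<i> * complex_of_real w)))\<^sup>2"
    using positive_poly_spectral_factor by blast
  \<comment> \<open>Only the mixed term involves \<open>cyc\<close> of full degree n; the total
    degree is at most 2n - 1, so the halved degree is still below n.\<close>
  have "degree g1 < CARD('n)" using g1(1) degree_numer[of v] degree_cyc by simp
  moreover have dg: "degree (g u) < CARD('n)" for u using g(1)[of u] degree_numer[of u] by simp
  moreover have "degree (\<Sum>i\<in>UNIV. g (axis i 1)) < CARD('n)"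
    by (rule degree_sum_less) (simp_all add: dg)
  ultimately have "degree G < CARD('n)"
    unfolding G_def by (intro degree_add_less degree_diff_less order_le_less_trans[OF degree_smult_le])
  then obtain l where l: "numer l = h" using numer_surj h(1) by fastforce
  have "ffun A B w \<kappa> \<theta> v = (l \<bullet> gre w)\<^sup>2 + (l \<bullet> gim w)\<^sup>2" for w
  proof -
    have "(cmod (?a w))\<^sup>2 * ffun A B w \<kappa> \<theta> v = (cmod (cpoly (numer l) (\<i> * complex_of_real w)))\<^sup>2"
      unfolding l h(2)[symmetric] by (rule pG[symmetric])
    also have "\<dots> = (cmod (?a w))\<^sup>2 * ((l \<bullet> gre w)\<^sup>2 + (l \<bullet> gim w)\<^sup>2)"
      unfolding num by (simp add: norm_mult power_mult_distrib cmod_power2[of "Complex _ _"])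
    finally have "(cmod (?a w))\<^sup>2 * ffun A B w \<kappa> \<theta> v = (cmod (?a w))\<^sup>2 * ((l \<bullet> gre w)\<^sup>2 + (l \<bullet> gim w)\<^sup>2)" .
    then show ?thesis using a[of w] by simp
  qed
  then show ?thesis by blast
qed

lemma frequency_imp_LMI:
  assumes pos: "\<And>w. ffun A B w \<kappa> (\<psi> + \<kappa> * (norm v)\<^sup>2) v > 0"
  shows "\<exists>P. LMI A B v \<kappa> \<psi> P"
proof -
  define c where "c = \<psi> + \<kappa> * (norm v)\<^sup>2"
  obtain l where l: "\<And>w. ffun A B w \<kappa> c v = (l \<bullet> gre w)\<^sup>2 + (l \<bullet> gim w)\<^sup>2"
    using frequency_spectral_factor[of \<kappa> c v] pos unfolding c_def by blast
  \<comment> \<open>W makes the slack in the LMI exactly the rank-one form (l^T x)^2.\<close>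
  define W where "W = \<kappa> *\<^sub>R outer v v - c *\<^sub>R mat 1 - outer l l"
  have W: "x \<bullet> (W *v x) = \<kappa> * (v \<bullet> x)\<^sup>2 - c * (norm x)\<^sup>2 - (l \<bullet> x)\<^sup>2" for x
    unfolding W_def
    by (simp only: matrix_vector_mult_diff_rdistrib scaleR_matrix_vector inner_diff_right outer_mult_vec)
      (simp add: dot_square_norm power2_eq_square inner_commute)
  have "symmetric_mat W"
    by (rule symmetric_matI) (simp add: W_def outer_def mat_def mult.commute)
  then obtain P where P: "symmetric_mat P" "lyap A P = W" using lyap_solvable by blast
  \<comment> \<open>The form of W summed over \<open>gre w\<close> and \<open>gim w\<close> is f - 2
    v^T \<open>gre\<close> - |l^T G|^2. The choice of l cancels f, and \<open>lyap_frequency\<close>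
    identifies the rest with -2 (P B)^T \<open>gre\<close>.\<close>
  have "(P *v B - v) \<bullet> gre w = 0" for w
    using lyap_frequency[OF P(1), of w] l[of w] unfolding P(2) W
    by (simp add: ffun_eq inner_diff_left algebra_simps)
  then have "P *v B = v" using orthogonal_gre_imp_zero[of "P *v B - v"] by simp
  then have "LMI A B v \<kappa> \<psi> P" unfolding LMI_iff P(2) W c_def using P(1) by simp
  then show ?thesis ..
qed

section \<open>Feasibility criterion, definiteness and the smallest eigenvalue\<close>

lemma Psi_set_nonempty_iff:
  assumes "\<kappa> > 0"
  shows "Psi_set A B v \<kappa> \<noteq> {} \<longleftrightarrow>
    (\<forall>w. ffun A B w \<kappa> (\<kappa> * (norm v)\<^sup>2) v > 0) \<and>
    (\<exists>L>0. ((\<lambda>w. ffun A B w \<kappa> (\<kappa> * (norm v)\<^sup>2) v / (norm (Gtf A B w))\<^sup>2) \<longlongrightarrow> L) at_top)"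
    (is "_ \<longleftrightarrow> (\<forall>w. ?f w > 0) \<and> (\<exists>L>0. (?r \<longlongrightarrow> L) at_top)")
proof (intro iffI conjI allI; (elim conjE exE)?)
  assume "Psi_set A B v \<kappa> \<noteq> {}"
  then obtain \<psi> P where "\<psi> > 0" and P: "LMI A B v \<kappa> \<psi> P" by (auto simp: Psi_set_def)
  have ge: "?f w \<ge> \<psi> * (norm (Gtf A B w))\<^sup>2" for w by (rule LMI_imp_ffun_ge[OF P])
  show "?f w > 0" for w
    using ge[of w] mult_pos_pos[OF \<open>\<psi> > 0\<close> norm_Gtf_pos, of w] by linarith
  obtain L where L: "(?r \<longlongrightarrow> L) at_top" using ffun_quotient_convergent by blast
  have "?r w \<ge> \<psi>" for w using ge[of w] norm_Gtf_pos[of w] by (simp add: le_divide_eq)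
  then have "L \<ge> \<psi>" by (intro tendsto_lowerbound[OF L]) auto
  then show "\<exists>L>0. (?r \<longlongrightarrow> L) at_top" using L \<open>\<psi> > 0\<close> by (intro exI[of _ L]) auto
next
  fix L assume pos: "\<forall>w. ?f w > 0" and L: "0 < L" "(?r \<longlongrightarrow> L) at_top"
  obtain \<psi> where "\<psi> > 0" and \<psi>: "\<And>w. ?f w > \<psi> * (norm (Gtf A B w))\<^sup>2"
    using uniform_margin[OF _ L(2,1)] pos by blast
  \<comment> \<open>Raising theta by psi subtracts psi |G|^2 from f, which the margin
    absorbs.\<close>
  have "ffun A B w \<kappa> (\<psi> + \<kappa> * (norm v)\<^sup>2) v > 0" for w
    using \<psi>[of w] by (simp add: ffun_def algebra_simps)
  then obtain P where "LMI A B v \<kappa> \<psi> P" using frequency_imp_LMI by blast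
  then show "Psi_set A B v \<kappa> \<noteq> {}" using \<open>\<psi> > 0\<close> by (auto simp: Psi_set_def)
qed

text \<open>By Cauchy-Schwarz the term kappa (v^T x)^2 is absorbed by kappa |v|^2 |x|^2, leaving at
  most -psi |x|^2.\<close>

lemma LMI_lyap_neg:
  assumes "\<kappa> \<ge> 0" "\<psi> > 0" "LMI A B v \<kappa> \<psi> P" "x \<noteq> 0"
  shows "x \<bullet> (lyap A P *v x) < 0"
proof -
  have "(v \<bullet> x)\<^sup>2 \<le> (norm v)\<^sup>2 * (norm x)\<^sup>2"
    using Cauchy_Schwarz_ineq[of v x] by (simp add: dot_square_norm)
  then have "\<kappa> * (v \<bullet> x)\<^sup>2 \<le> \<kappa> * ((norm v)\<^sup>2 * (norm x)\<^sup>2)"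
    using assms(1) by (rule mult_left_mono)
  moreover have "\<psi> * (norm x)\<^sup>2 > 0" using assms(2,4) by simp
  moreover have "x \<bullet> (lyap A P *v x) \<le> \<kappa> * (v \<bullet> x)\<^sup>2 - (\<psi> + \<kappa> * (norm v)\<^sup>2) * (norm x)\<^sup>2"
    using assms(3) unfolding LMI_iff by blast
  ultimately show ?thesis by (simp add: algebra_simps)
qed

lemma lambda_min_increases:
  assumes P: "LMI A B v \<kappa> \<psi> P" and w: "ffun A B w 0 (\<psi> + \<kappa> * (norm v)\<^sup>2) v < 0"
  shows "lambda_min (- lyap A P + P ** outer B B ** P) > lambda_min (- lyap A P)"
proof (rule ccontr)
  define c where "c = \<psi> + \<kappa> * (norm v)\<^sup>2"
  define Q where "Q = - lyap A P"
  from P have sym: "symmetric_mat P" and PB: "P *v B = v"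
    and le: "\<And>x. x \<bullet> (lyap A P *v x) \<le> \<kappa> * (v \<bullet> x)\<^sup>2 - c * (norm x)\<^sup>2"
    by (auto simp: LMI_iff c_def)
  have Qx: "x \<bullet> (Q *v x) = - (x \<bullet> (lyap A P *v x))" for x
    using matrix_vector_mult_diff_rdistrib[of 0 "lyap A P" x] by (simp add: Q_def)
  have symQ: "symmetric_mat Q"
    using symmetric_lyap[OF sym, of A] by (auto simp: symmetric_mat_def Q_def transpose_def vec_eq_iff)
  have "(P ** outer B B ** P) *v x = (v \<bullet> x) *\<^sub>R v" for x
    using symmetric_inner[OF sym, of B x]
    by (simp add: matrix_vector_mul_assoc[symmetric] outer_mult_vec matrix_vector_mult_scaleR PB)
  then have "(P ** outer B B ** P) *v x = outer v v *v x" for x by (simp add: outer_mult_vec)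
  then have PBBP: "P ** outer B B ** P = outer v v" by (simp add: matrix_eq)
  have symQv: "symmetric_mat (Q + outer v v)"
    using symQ by (auto simp: symmetric_mat_def transpose_def vec_eq_iff outer_def mult.commute)
  \<comment> \<open>The Rayleigh bound at the real and imaginary parts of G, combined with the
    negative frequency value, places \<open>lambda_min Q\<close> strictly below c.\<close>
  have "lambda_min Q * (norm (Gtf A B w))\<^sup>2 \<le> gre w \<bullet> (Q *v gre w) + gim w \<bullet> (Q *v gim w)"
    using lambda_min_props(1)[OF symQ, of "gre w"] lambda_min_props(1)[OF symQ, of "gim w"]
    by (simp add: norm_Gtf algebra_simps)
  also have "\<dots> = 2 * (v \<bullet> gre w)" using lyap_frequency[OF sym, of w] by (simp add: Qx PB)
  also have "\<dots> < c * (norm (Gtf A B w))\<^sup>2" using w by (simp add: ffun_eq norm_Gtf c_def)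
  finally have less: "lambda_min Q < c" using norm_Gtf_pos[of w] by (simp add: mult_less_cancel_right)
  assume "\<not> lambda_min (- lyap A P + P ** outer B B ** P) > lambda_min (- lyap A P)"
  then have *: "lambda_min (Q + outer v v) \<le> lambda_min Q" by (simp add: PBBP Q_def)
  obtain x where x: "x \<noteq> 0" "(Q + outer v v) *v x = lambda_min (Q + outer v v) *\<^sub>R x"
    using lambda_min_props(2)[OF symQv] by blast
  have "x \<bullet> (Q *v x) + (v \<bullet> x)\<^sup>2 = x \<bullet> ((Q + outer v v) *v x)"
    by (simp add: matrix_vector_mult_add_rdistrib inner_add_right outer_mult_vec power2_eq_square inner_commute)
  also have "\<dots> = lambda_min (Q + outer v v) * (norm x)\<^sup>2" unfolding x(2) by (simp add: dot_square_norm)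
  also have "\<dots> \<le> lambda_min Q * (norm x)\<^sup>2" using * by (rule mult_right_mono) simp
  finally have upper: "x \<bullet> (Q *v x) + (v \<bullet> x)\<^sup>2 \<le> lambda_min Q * (norm x)\<^sup>2" .
  then have "(v \<bullet> x)\<^sup>2 \<le> 0" using lambda_min_props(1)[OF symQ, of x] by linarith
  then have "v \<bullet> x = 0" by simp
  \<comment> \<open>Where v^T x = 0 the LMI says that the form of Q is at least c |x|^2, contrary to
    \<open>lambda_min Q < c\<close>.\<close>
  then have "c * (norm x)\<^sup>2 \<le> lambda_min Q * (norm x)\<^sup>2" using upper le[of x] Qx[of x] by simp
  then show False using less x(1) by (simp add: mult_le_cancel_right)
qed

end

theorem theorem3:
  fixes A :: "real^'n^'n" and B v :: "real^'n" and \<kappa> :: real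
  assumes "hurwitz A" and "controllable A B" and "\<kappa> > 0"
  shows "(Psi_set A B v \<kappa> \<noteq> {} \<longleftrightarrow>
            (\<forall>w. ffun A B w \<kappa> (\<kappa> * (norm v)\<^sup>2) v > 0) \<and>
            (\<exists>L>0. ((\<lambda>w. ffun A B w \<kappa> (\<kappa> * (norm v)\<^sup>2) v / (norm (Gtf A B w))\<^sup>2) \<longlongrightarrow> L) at_top))
       \<and> (\<forall>\<psi> \<in> Psi_set A B v \<kappa>. \<forall>P. LMI A B v \<kappa> \<psi> P \<longrightarrow>
            (let Q = - (transpose A ** P + P ** A) in
              pos_def P \<and> pos_def Q \<and>
              ((\<exists>w. ffun A B w 0 (\<psi> + \<kappa> * (norm v)\<^sup>2) v < 0) \<longrightarrow>
                 lambda_min (Q + P ** outer B B ** P) > lambda_min Q)))"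
proof -
  interpret hurwitz_pair A B using assms(1,2) by unfold_locales
  show ?thesis
    unfolding Let_def lyap_def[symmetric]
  proof (intro conjI ballI allI impI)
    show "Psi_set A B v \<kappa> \<noteq> {} \<longleftrightarrow>
            (\<forall>w. ffun A B w \<kappa> (\<kappa> * (norm v)\<^sup>2) v > 0) \<and>
            (\<exists>L>0. ((\<lambda>w. ffun A B w \<kappa> (\<kappa> * (norm v)\<^sup>2) v / (norm (Gtf A B w))\<^sup>2) \<longlongrightarrow> L) at_top)"
      by (rule Psi_set_nonempty_iff[OF assms(3)])
  next
    fix \<psi> P assume "\<psi> \<in> Psi_set A B v \<kappa>" and P: "LMI A B v \<kappa> \<psi> P"
    then have "\<psi> > 0" by (simp add: Psi_set_def)
    then have neg: "x \<bullet> (lyap A P *v x) < 0" if "x \<noteq> 0" for x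
      using LMI_lyap_neg[of \<kappa> \<psi>] assms(3) P that by simp
    show "pos_def P" using neg P unfolding LMI_def by (intro lyap_pos_def) auto
    show "pos_def (- lyap A P)"
      using neg matrix_vector_mult_diff_rdistrib[of 0 "lyap A P"] by (simp add: pos_def_def)
    assume "\<exists>w. ffun A B w 0 (\<psi> + \<kappa> * (norm v)\<^sup>2) v < 0"
    then show "lambda_min (- lyap A P + P ** outer B B ** P) > lambda_min (- lyap A P)"
      using lambda_min_increases[OF P] by blast
  qed
qed

end
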